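(* Let $\Gamma\subset\mathbb{R}^d$ be an acute closed convex solid cone, $\mu$ a finite positive measure on $\Gamma^*$, $\lambda\in\operatorname{int}\Gamma$ and $n\in\mathbb{N}$. Let $H_n$, $\pi_n$, and the operators $X^{(n)}_1,\dots,X^{(n)}_d$ on $H_n$ be as in the context, put $v=\pi_n1$, $A_j=X_j^{(n)}$, $A=(A_1,\dots,A_d)$, $L(x)=x\cdot A$. Assume that $L(p)$ is positive semi-definite for every vector $p$ lying on an extreme ray of $\Gamma$, and that there exist $d$ linearly independent vectors $v^{(1)},\dots,v^{(d)}$ chosen from the extreme rays of $\Gamma$ such that for all $i,j\in\{1,\dots,d\}$ the Weyl-symmetrized words $C_{k,1}(L(v^{(i)}),L(v^{(j)}))$ are positive semi-definite for all $k\ge1$. Then the function $$\Phi_n(z,z_0)=\langle(z_0+z\cdot A)^{-1}v,v\rangle,\qquad(z,z_0)\in T_{\Gamma\times\mathbb{R}_+},$$ is of the form $$\Phi_n(z,z_0)=\sum_{j=1}^{\dim H_n}\frac{\gamma_j}{z_0+z\cdot\lambda^{(j)}}$$ for some $\gamma_j\ge0$ and $\lambda^{(j)}\in\Gamma^*$.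
   Context: Acute means containing no line; solid means with non-empty interior. $\Gamma^*=\{y\in\mathbb{R}^d: y\cdot x\ge 0\ \forall x\in\Gamma\}$; $T_{\Gamma\times\mathbb{R}_+}=(\operatorname{int}\Gamma\times(0,\infty))+i\,\mathbb{R}^{d+1}\subset\mathbb{C}^{d+1}$. Inside $L^2_{\mathbb{R}}(\Gamma^*,\mu)$ let $$H_n=\operatorname{span}_{\mathbb{R}}\Big\{\tfrac{x^\alpha}{(1+\lambda\cdot x)^{|\alpha|+j}}:(\alpha,j)\in\mathbb{N}_0^d\times\mathbb{N}_0,\ |\alpha|+j\le n\Big\},$$ $$L_n=\operatorname{span}_{\mathbb{R}}\Big\{\tfrac{x^\alpha}{(1+\lambda\cdot x)^{|\alpha|+j}}:|\alpha|+j\le n,\ j\ge1\Big\}\subset H_n .$$ If $f\in L_n$ then $x_jf\in H_{n+1}$. Let $\pi_n$ be the orthogonal projection (of $H_{n+1}\supset H_n$) onto $L_n$, let $X_j$ be multiplication by $x_j$, and define $X^{(n)}_jf=\pi_nX_j\pi_nf$ for $f\in H_n$, $1\le j\le d$; these are real symmetric operators on the finite-dimensional space $H_n$ (complexified when needed). The constant function $1$ belongs to $H_n$. For operators $X,Y$, $C_{k,1}(X,Y)=\sum_{j=0}^kX^{k-j}YX^j$, the coefficient of $s^kt$ in $(sX+tY)^{k+1}$. *)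

theory Defs
  imports "HOL-Analysis.Analysis" "HOL-Library.Function_Algebras"
begin

subsection \<open>Functions as a real vector space\<close>

instantiation "fun" :: (type, real_vector) real_vector
begin

definition scaleR_fun :: "real \<Rightarrow> ('a \<Rightarrow> 'b) \<Rightarrow> 'a \<Rightarrow> 'b"
  where "scaleR_fun c f = (\<lambda>x. c *\<^sub>R f x)"

instance
  by standard (simp_all add: scaleR_fun_def fun_eq_iff scaleR_add_right scaleR_add_left)

end

subsection \<open>Cones\<close>

definition dual_cone :: "'a::real_inner set \<Rightarrow> 'a set"
  where "dual_cone \<Gamma> = {y. \<forall>x\<in>\<Gamma>. 0 \<le> y \<bullet> x}"

definition acute :: "'a::real_vector set \<Rightarrow> bool"
  where "acute \<Gamma> \<longleftrightarrow> \<not> (\<exists>a v. v \<noteq> 0 \<and> range (\<lambda>t. a + t *\<^sub>R v) \<subseteq> \<Gamma>)"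

definition solid :: "'a::topological_space set \<Rightarrow> bool"
  where "solid \<Gamma> \<longleftrightarrow> interior \<Gamma> \<noteq> {}"

definition extreme_ray :: "'a::real_vector set \<Rightarrow> 'a set \<Rightarrow> bool"
  where "extreme_ray R \<Gamma> \<longleftrightarrow> R face_of \<Gamma> \<and> (\<exists>v. v \<noteq> 0 \<and> R = {t *\<^sub>R v |t. 0 \<le> t})"

definition Re_vec :: "complex ^ 'd \<Rightarrow> real ^ 'd"
  where "Re_vec z = (\<chi> i. Re (z $ i))"

text \<open>The tube over \<open>int \<Gamma> \<times> (0,\<infinity>)\<close>, with \<open>\<complex>\<^sup>d\<^sup>+\<^sup>1\<close> written as \<open>\<complex>\<^sup>d \<times> \<complex>\<close>.\<close>

definition tube :: "(real ^ 'd) set \<Rightarrow> ((complex ^ 'd) \<times> complex) set"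
  where "tube \<Gamma> = {(z, z0). Re_vec z \<in> interior \<Gamma> \<and> 0 < Re z0}"

subsection \<open>Linear algebra in \<open>L\<^sup>2(M)\<close>\<close>

text \<open>
  Elements of \<open>L\<^sup>2(M)\<close> are represented by functions, and equality in \<open>L\<^sup>2(M)\<close> is equality
  \<open>M\<close>-almost everywhere. An operator on a subspace of \<open>L\<^sup>2(M)\<close> is a map on representatives;
  the ones below respect almost-everywhere equality and are linear up to it.
\<close>

definition L2_inner :: "'a measure \<Rightarrow> ('a \<Rightarrow> real) \<Rightarrow> ('a \<Rightarrow> real) \<Rightarrow> real"
  where "L2_inner M f g = (\<integral>x. f x * g x \<partial>M)"

definition L2_cinner :: "'a measure \<Rightarrow> ('a \<Rightarrow> complex) \<Rightarrow> ('a \<Rightarrow> complex) \<Rightarrow> complex"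
  where "L2_cinner M f g = (\<integral>x. f x * cnj (g x) \<partial>M)"

definition L2_independent :: "'a measure \<Rightarrow> ('a \<Rightarrow> real) set \<Rightarrow> bool"
  where "L2_independent M B \<longleftrightarrow>
    (\<forall>c. (AE x in M. (\<Sum>b\<in>B. c b * b x) = 0) \<longrightarrow> (\<forall>b\<in>B. c b = 0))"

text \<open>Dimension of the (finite-dimensional) image in \<open>L\<^sup>2(M)\<close> of a space \<open>V\<close> of functions. It can
  be smaller than \<open>dim V\<close>, for instance when \<open>M\<close> has finite support.\<close>

definition L2_dim :: "'a measure \<Rightarrow> ('a \<Rightarrow> real) set \<Rightarrow> nat"
  where "L2_dim M V =
    (GREATEST m. \<exists>B\<subseteq>V. finite B \<and> card B = m \<and> L2_independent M B)"

text \<open>Orthogonal projection onto \<open>V\<close>; the chosen value is unique almost everywhere.\<close>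

definition L2_proj :: "'a measure \<Rightarrow> ('a \<Rightarrow> real) set \<Rightarrow> ('a \<Rightarrow> real) \<Rightarrow> 'a \<Rightarrow> real"
  where "L2_proj M V f = (SOME p. p \<in> V \<and> (\<forall>g\<in>V. L2_inner M (f - p) g = 0))"

definition L2_psd_on :: "'a measure \<Rightarrow> ('a \<Rightarrow> real) set \<Rightarrow> (('a \<Rightarrow> real) \<Rightarrow> 'a \<Rightarrow> real) \<Rightarrow> bool"
  where "L2_psd_on M V T \<longleftrightarrow>
    (\<forall>f\<in>V. \<forall>g\<in>V. L2_inner M (T f) g = L2_inner M f (T g)) \<and>
    (\<forall>f\<in>V. 0 \<le> L2_inner M (T f) f)"

definition complexify_space :: "('a \<Rightarrow> real) set \<Rightarrow> ('a \<Rightarrow> complex) set"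
  where "complexify_space V = {u. (\<lambda>x. Re (u x)) \<in> V \<and> (\<lambda>x. Im (u x)) \<in> V}"

definition complexify_op ::
    "(('a \<Rightarrow> real) \<Rightarrow> 'a \<Rightarrow> real) \<Rightarrow> ('a \<Rightarrow> complex) \<Rightarrow> 'a \<Rightarrow> complex"
  where "complexify_op T u =
    (\<lambda>x. Complex (T (\<lambda>y. Re (u y)) x) (T (\<lambda>y. Im (u y)) x))"

text \<open>Inverse of the operator \<open>T\<close> on the subspace \<open>W\<close> of complex \<open>L\<^sup>2(M)\<close>. When \<open>T\<close> is invertible
  on \<open>W\<close>, the chosen value is unique almost everywhere.\<close>

definition L2_inv_on ::
    "'a measure \<Rightarrow> ('a \<Rightarrow> complex) set \<Rightarrow> (('a \<Rightarrow> complex) \<Rightarrow> 'a \<Rightarrow> complex)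
      \<Rightarrow> ('a \<Rightarrow> complex) \<Rightarrow> 'a \<Rightarrow> complex"
  where "L2_inv_on M W T g = (SOME u. u \<in> W \<and> (AE x in M. T u x = g x))"

subsection \<open>The spaces and operators of the truncated multiplication problem\<close>

text \<open>Multi-indices are functions \<open>'d \<Rightarrow> nat\<close>, with \<open>|\<alpha>| = sum \<alpha> UNIV\<close>.\<close>

definition frac_monom :: "real ^ 'd \<Rightarrow> ('d::finite \<Rightarrow> nat) \<Rightarrow> nat \<Rightarrow> real ^ 'd \<Rightarrow> real"
  where "frac_monom l \<alpha> j x = (\<Prod>i\<in>UNIV. (x $ i) ^ \<alpha> i) / (1 + l \<bullet> x) ^ (sum \<alpha> UNIV + j)"

definition H_space :: "real ^ 'd \<Rightarrow> nat \<Rightarrow> (real ^ 'd::finite \<Rightarrow> real) set"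
  where "H_space l n = span {frac_monom l \<alpha> j |\<alpha> j. sum \<alpha> UNIV + j \<le> n}"

definition L_space :: "real ^ 'd \<Rightarrow> nat \<Rightarrow> (real ^ 'd::finite \<Rightarrow> real) set"
  where "L_space l n = span {frac_monom l \<alpha> j |\<alpha> j. sum \<alpha> UNIV + j \<le> n \<and> 1 \<le> j}"

definition pi_n ::
    "(real ^ 'd) measure \<Rightarrow> real ^ 'd \<Rightarrow> nat \<Rightarrow> (real ^ 'd::finite \<Rightarrow> real) \<Rightarrow> real ^ 'd \<Rightarrow> real"
  where "pi_n \<mu> l n = L2_proj \<mu> (L_space l n)"

definition mult_op :: "'d \<Rightarrow> (real ^ 'd::finite \<Rightarrow> real) \<Rightarrow> real ^ 'd \<Rightarrow> real"
  where "mult_op j f = (\<lambda>x. x $ j * f x)"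

definition A_op ::
    "(real ^ 'd) measure \<Rightarrow> real ^ 'd \<Rightarrow> nat \<Rightarrow> 'd
      \<Rightarrow> (real ^ 'd::finite \<Rightarrow> real) \<Rightarrow> real ^ 'd \<Rightarrow> real"
  where "A_op \<mu> l n j f = pi_n \<mu> l n (mult_op j (pi_n \<mu> l n f))"

definition L_op ::
    "(real ^ 'd) measure \<Rightarrow> real ^ 'd \<Rightarrow> nat \<Rightarrow> real ^ 'd
      \<Rightarrow> (real ^ 'd::finite \<Rightarrow> real) \<Rightarrow> real ^ 'd \<Rightarrow> real"
  where "L_op \<mu> l n p = (\<Sum>j\<in>UNIV. p $ j *\<^sub>R A_op \<mu> l n j)"

definition weyl_word :: "nat \<Rightarrow> ('v \<Rightarrow> 'v) \<Rightarrow> ('v \<Rightarrow> 'v) \<Rightarrow> 'v \<Rightarrow> 'v::ab_group_add"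
  where "weyl_word k X Y = (\<Sum>j\<le>k. (X ^^ (k - j)) \<circ> Y \<circ> (X ^^ j))"

text \<open>The operator \<open>z\<^sub>0 + z \<cdot> A\<close> on the complexification of \<open>H\<^sub>n\<close>.\<close>

definition pencil ::
    "(real ^ 'd) measure \<Rightarrow> real ^ 'd \<Rightarrow> nat \<Rightarrow> complex ^ 'd \<Rightarrow> complex
      \<Rightarrow> (real ^ 'd::finite \<Rightarrow> complex) \<Rightarrow> real ^ 'd \<Rightarrow> complex"
  where "pencil \<mu> l n z z0 u =
    (\<lambda>x. z0 * u x + (\<Sum>j\<in>UNIV. z $ j * complexify_op (A_op \<mu> l n j) u x))"

definition Phi ::
    "(real ^ 'd::finite) measure \<Rightarrow> real ^ 'd \<Rightarrow> nat \<Rightarrow> complex ^ 'd \<Rightarrow> complex \<Rightarrow> complex"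
  where "Phi \<mu> l n z z0 =
    (let v = (\<lambda>x. complex_of_real (pi_n \<mu> l n (\<lambda>_. 1) x))
     in L2_cinner \<mu>
          (L2_inv_on \<mu> (complexify_space (H_space l n)) (pencil \<mu> l n z z0) v) v)"

end

theory Submission
  imports Defs
begin

text \<open>
  Positivity of all words \<open>C\<^sub>k\<^sub>,\<^sub>1(X, Y)\<close> for a positive semidefinite \<open>X\<close> forces \<open>X\<close> and \<open>Y\<close> to
  commute: in an eigenbasis of \<open>X\<close> the \<open>2 \<times> 2\<close> minor belonging to two distinct eigenvalues becomes
  negative for large \<open>k\<close> unless the corresponding entry of \<open>Y\<close> is zero. Hence the \<open>L(v\<^sup>(\<^sup>i\<^sup>))\<close>, and
  with them \<open>A\<^sub>1, \<dots>, A\<^sub>d\<close>, have a common orthonormal eigenbasis; expanding \<open>v = \<pi>\<^sub>n 1\<close> in it gives the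
  partial fractions. The joint eigenvalues lie in \<open>\<Gamma>\<^sup>*\<close> because \<open>L(p)\<close> is positive semidefinite
  for all \<open>p \<in> \<Gamma>\<close>, being a compression of multiplication by \<open>p \<cdot> x \<ge> 0\<close>.

  Elements of \<open>L\<^sup>2\<close> are functions rather than classes, so the linear algebra is done for forms that
  are only semidefinite, and operators are linear only up to null vectors. Both this and the
  invariance under null perturbations follow from symmetry of the operator.
\<close>

lemma sum_fun_apply: "(\<Sum>i\<in>I. f i) x = (\<Sum>i\<in>I. f i x)"
  by (induction I rule: infinite_finite_induct) auto

lemma scaleR_fun_apply: "(c *\<^sub>R f) x = c *\<^sub>R f x"
  by (simp add: scaleR_fun_def)

section \<open>Positive semidefinite forms\<close>

locale psd_form =
  fixes G :: "'b::real_vector set" and B :: "'b \<Rightarrow> 'b \<Rightarrow> real"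
  assumes subspace_carrier: "subspace G"
    and sym: "\<And>f g. f \<in> G \<Longrightarrow> g \<in> G \<Longrightarrow> B f g = B g f"
    and add_left: "\<And>f g h. f \<in> G \<Longrightarrow> g \<in> G \<Longrightarrow> h \<in> G \<Longrightarrow> B (f + g) h = B f h + B g h"
    and scale_left: "\<And>c f h. f \<in> G \<Longrightarrow> h \<in> G \<Longrightarrow> B (c *\<^sub>R f) h = c * B f h"
    and nonneg: "\<And>f. f \<in> G \<Longrightarrow> 0 \<le> B f f"
begin

lemma closed_simps [simp, intro]:
  "0 \<in> G"
  "f \<in> G \<Longrightarrow> g \<in> G \<Longrightarrow> f + g \<in> G"
  "f \<in> G \<Longrightarrow> g \<in> G \<Longrightarrow> f - g \<in> G"
  "f \<in> G \<Longrightarrow> c *\<^sub>R f \<in> G"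
  "(\<And>i. i \<in> I \<Longrightarrow> h i \<in> G) \<Longrightarrow> sum h I \<in> G"
  using subspace_carrier subspace_0 subspace_add subspace_diff subspace_scale subspace_sum by blast+

lemma diff_left:
  assumes "f \<in> G" "g \<in> G" "h \<in> G"
  shows "B (f - g) h = B f h - B g h"
  using add_left[of "f - g" g h] assms by simp

lemma zero_left: "h \<in> G \<Longrightarrow> B 0 h = 0"
  using scale_left[of h h 0] by simp

lemma add_right: "f \<in> G \<Longrightarrow> g \<in> G \<Longrightarrow> h \<in> G \<Longrightarrow> B h (f + g) = B h f + B h g"
  by (simp add: sym[of h] add_left)

lemma diff_right: "f \<in> G \<Longrightarrow> g \<in> G \<Longrightarrow> h \<in> G \<Longrightarrow> B h (f - g) = B h f - B h g"
  by (simp add: sym[of h] diff_left)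

lemma scale_right: "f \<in> G \<Longrightarrow> h \<in> G \<Longrightarrow> B h (c *\<^sub>R f) = c * B h f"
  by (simp add: sym[of h] scale_left)

lemma sum_left:
  assumes "\<And>i. i \<in> I \<Longrightarrow> f i \<in> G" "h \<in> G"
  shows "B (\<Sum>i\<in>I. f i) h = (\<Sum>i\<in>I. B (f i) h)"
  using assms by (induction I rule: infinite_finite_induct) (simp_all add: zero_left add_left)

lemma lincomb_left:
  assumes "\<And>i. i \<in> I \<Longrightarrow> f i \<in> G" "h \<in> G"
  shows "B (\<Sum>i\<in>I. c i *\<^sub>R f i) h = (\<Sum>i\<in>I. c i * B (f i) h)"
  using assms by (simp add: sum_left scale_left)

text \<open>The quadratic form of \<open>B\<close> on \<open>a f + b g\<close> is nonnegative for
  all real \<open>a\<close>, \<open>b\<close>. As \<open>B\<close> may have null vectors, the case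
  \<open>B g g = 0\<close> needs its own test values.\<close>

lemma Cauchy_Schwarz:
  assumes "f \<in> G" "g \<in> G"
  shows "(B f g)\<^sup>2 \<le> B f f * B g g"
proof -
  define p q r where "p = B f f" and "q = B f g" and "r = B g g"
  have quad: "0 \<le> a\<^sup>2 * p + 2 * a * b * q + b\<^sup>2 * r" for a b
    using nonneg[of "a *\<^sub>R f + b *\<^sub>R g"] assms sym[of g f]
    by (simp add: add_left add_right scale_left scale_right p_def q_def r_def
        power2_eq_square algebra_simps)
  have "0 \<le> p" "0 \<le> r" using assms nonneg by (auto simp: p_def r_def)
  have "q\<^sup>2 \<le> p * r"
  proof (cases "r = 0")
    case True
    \<comment> \<open>With \<open>r = 0\<close> the test value \<open>b = - (p + 1)\<close>
      outweighs the term \<open>q\<^sup>2 * p\<close>.\<close>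
    have "q\<^sup>2 * (p + 2) \<le> 0"
      using quad[of q "- (p + 1)"] True by (simp add: power2_eq_square algebra_simps)
    then show ?thesis using \<open>0 \<le> p\<close> True by (simp add: mult_le_0_iff)
  next
    case False
    then have "0 < r" using \<open>0 \<le> r\<close> by simp
    have "0 \<le> r * (p * r - q\<^sup>2)"
      using quad[of r "- q"] by (simp add: power2_eq_square algebra_simps)
    then show ?thesis using \<open>0 < r\<close> by (simp add: zero_le_mult_iff)
  qed
  then show ?thesis by (simp add: p_def q_def r_def)
qed

text \<open>A null vector lies in the radical of the form. This stands in for passing to the
  quotient by null vectors.\<close>

lemma null_left:
  assumes "f \<in> G" "g \<in> G" "B f f = 0"
  shows "B f g = 0"
  using Cauchy_Schwarz[of f g] assms by simp

lemma psd_form_subspace: "subspace V \<Longrightarrow> V \<subseteq> G \<Longrightarrow> psd_form V B"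
  by unfold_locales (auto simp: add_left scale_left nonneg subset_iff intro: sym)

section \<open>Symmetric operators on a semidefinite space\<close>

definition symmetric :: "('b \<Rightarrow> 'b) \<Rightarrow> bool"
  where "symmetric T \<longleftrightarrow> (\<forall>f\<in>G. T f \<in> G) \<and> (\<forall>f\<in>G. \<forall>g\<in>G. B (T f) g = B f (T g))"

lemma symmetric_closed: "symmetric T \<Longrightarrow> f \<in> G \<Longrightarrow> T f \<in> G"
  by (simp add: symmetric_def)

lemma symmetric_swap: "symmetric T \<Longrightarrow> f \<in> G \<Longrightarrow> g \<in> G \<Longrightarrow> B (T f) g = B f (T g)"
  by (simp add: symmetric_def)

text \<open>\<open>T\<close> need not be linear, but \<open>B (T f) h = B f (T h)\<close> is linear
  in \<open>f\<close>. The new form brings its own Cauchy-Schwarz inequality, which is applied to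
  \<open>c - T\<close> for a maximal Rayleigh quotient \<open>c\<close> and to the Weyl
  words.\<close>

lemma psd_form_operator:
  assumes T: "symmetric T" and "\<And>f. f \<in> G \<Longrightarrow> 0 \<le> B (T f) f"
  shows "psd_form G (\<lambda>f g. B (T f) g)"
proof
  fix f g h c assume "f \<in> G" "g \<in> G" "h \<in> G"
  then show "B (T f) g = B (T g) f"
    using symmetric_swap[OF T, of f g] symmetric_closed[OF T, of g] sym[of f "T g"] by simp
  show "B (T (f + g)) h = B (T f) h + B (T g) h"
    using T \<open>f \<in> G\<close> \<open>g \<in> G\<close> \<open>h \<in> G\<close> by (simp add: symmetric_swap symmetric_closed add_left)
next
  fix c f h assume "f \<in> G" "h \<in> G"
  then show "B (T (c *\<^sub>R f)) h = c * B (T f) h"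
    using T by (simp add: symmetric_swap symmetric_closed scale_left)
qed (use assms in \<open>auto simp: subspace_carrier\<close>)

section \<open>Orthonormal systems and Fourier expansions modulo null vectors\<close>

definition orthonormal :: "'b set \<Rightarrow> bool"
  where "orthonormal E \<longleftrightarrow>
    finite E \<and> E \<subseteq> G \<and> (\<forall>e\<in>E. \<forall>e'\<in>E. B e e' = (if e = e' then 1 else 0))"

text \<open>Completeness replaces spanning: a vector orthogonal to \<open>E\<close> is null, though
  not necessarily zero.\<close>

definition orthonormal_basis :: "'b set \<Rightarrow> bool"
  where "orthonormal_basis E \<longleftrightarrow>
    orthonormal E \<and> (\<forall>f\<in>G. (\<forall>e\<in>E. B f e = 0) \<longrightarrow> B f f = 0)"

lemma orthonormal_coeff:
  assumes "orthonormal E" "e' \<in> E"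
  shows "B (\<Sum>e\<in>E. c e *\<^sub>R e) e' = c e'"
proof -
  have "B (\<Sum>e\<in>E. c e *\<^sub>R e) e' = (\<Sum>e\<in>E. c e * B e e')"
    using assms by (intro lincomb_left) (auto simp: orthonormal_def)
  also have "\<dots> = (\<Sum>e\<in>E. if e = e' then c e else 0)"
    using assms by (intro sum.cong) (auto simp: orthonormal_def)
  also have "\<dots> = c e'" using assms by (simp add: orthonormal_def)
  finally show ?thesis .
qed

lemma orthonormal_independent:
  assumes "orthonormal E"
  shows "independent E"
proof -
  have "finite E" "E \<subseteq> G" using assms by (auto simp: orthonormal_def)
  have "u e = 0" if "(\<Sum>e\<in>E. u e *\<^sub>R e) = 0" "e \<in> E" for u e
    using orthonormal_coeff[OF assms that(2), of u] that \<open>E \<subseteq> G\<close> zero_left[of e] by auto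
  then show ?thesis using \<open>finite E\<close> by (auto simp: dependent_finite)
qed

lemma basis_residual:
  assumes E: "orthonormal_basis E" and "f \<in> G"
  shows "B (f - (\<Sum>e\<in>E. B f e *\<^sub>R e)) (f - (\<Sum>e\<in>E. B f e *\<^sub>R e)) = 0"
proof -
  have on: "orthonormal E" and EG: "E \<subseteq> G"
    using E by (auto simp: orthonormal_basis_def orthonormal_def)
  have s: "(\<Sum>e\<in>E. B f e *\<^sub>R e) \<in> G" using EG by auto
  have "B (f - (\<Sum>e\<in>E. B f e *\<^sub>R e)) e' = 0" if "e' \<in> E" for e'
    using that EG s \<open>f \<in> G\<close> orthonormal_coeff[OF on that, of "B f"] diff_left by auto
  then show ?thesis using E s \<open>f \<in> G\<close> by (auto simp: orthonormal_basis_def)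
qed

text \<open>By completeness \<open>f\<close> differs from its Fourier sum by a null vector, which is
  invisible to \<open>B\<close>.\<close>

lemma Parseval:
  assumes E: "orthonormal_basis E" and "f \<in> G" "g \<in> G"
  shows "B f g = (\<Sum>e\<in>E. B f e * B e g)"
proof -
  have EG: "E \<subseteq> G" using E by (auto simp: orthonormal_basis_def orthonormal_def)
  have s: "(\<Sum>e\<in>E. B f e *\<^sub>R e) \<in> G" using EG by auto
  have "B (f - (\<Sum>e\<in>E. B f e *\<^sub>R e)) g = 0"
    using null_left[OF closed_simps(3)[OF \<open>f \<in> G\<close> s] \<open>g \<in> G\<close> basis_residual[OF E \<open>f \<in> G\<close>]] .
  then have "B f g = B (\<Sum>e\<in>E. B f e *\<^sub>R e) g"
    using diff_left[OF \<open>f \<in> G\<close> s \<open>g \<in> G\<close>] by simp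
  also have "\<dots> = (\<Sum>e\<in>E. B f e * B e g)"
    using EG assms by (intro lincomb_left) auto
  finally show ?thesis .
qed

text \<open>Orthonormal sets are independent, so their size is bounded by \<open>card S\<close>; one
  of greatest size inside \<open>V\<close> cannot be enlarged by a unit vector of \<open>V\<close>.
  \<open>V\<close> is an arbitrary set because it will also be the set of common eigenvectors, which
  is no subspace in general.\<close>

lemma maximal_orthonormal:
  assumes "V \<subseteq> G" "V \<subseteq> span S" "finite S"
  obtains E where "orthonormal E" "E \<subseteq> V"
    "\<And>f. f \<in> V \<Longrightarrow> B f f = 1 \<Longrightarrow> \<exists>e\<in>E. B f e \<noteq> 0"
proof -
  let ?P = "\<lambda>E. orthonormal E \<and> E \<subseteq> V"
  have "?P {}" by (simp add: orthonormal_def)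
  moreover have "\<forall>E. ?P E \<longrightarrow> card E \<le> card S"
    using assms independent_span_bound[of S] orthonormal_independent by blast
  ultimately obtain E where E: "?P E" and max: "\<And>F. ?P F \<Longrightarrow> card F \<le> card E"
    using ex_has_greatest_nat[of ?P "{}" card "Suc (card S)"] by (auto simp: less_Suc_eq_le)
  show ?thesis
  proof
    fix f assume f: "f \<in> V" "B f f = 1"
    show "\<exists>e\<in>E. B f e \<noteq> 0"
    proof (rule ccontr)
      assume "\<not> ?thesis"
      then have 0: "\<forall>e\<in>E. B f e = 0" by blast
      then have "f \<notin> E" using f by auto
      have fG: "f \<in> G" using f assms by auto
      have "\<forall>e\<in>E. B e f = 0"
        using 0 E fG sym[of _ f] by (auto simp: orthonormal_def)
      then have "?P (insert f E)"
        using E f 0 fG \<open>f \<notin> E\<close> by (auto simp: orthonormal_def)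
      from max[OF this] show False
        using \<open>f \<notin> E\<close> E by (simp add: orthonormal_def)
    qed
  qed (use E in auto)
qed

lemma normalize:
  assumes "f \<in> G" "B f f \<noteq> 0"
  shows "B ((1 / sqrt (B f f)) *\<^sub>R f) ((1 / sqrt (B f f)) *\<^sub>R f) = 1"
  using assms nonneg[of f] by (simp add: scale_left scale_right)

end

section \<open>Spectral theorem on finitely generated spaces\<close>

locale finite_psd_form = psd_form +
  fixes S
  assumes finite_generators: "finite S" and carrier_span: "G \<subseteq> span S"
begin

text \<open>The generators only have to span a superset of the carrier, so the same \<open>S\<close>
  serves every subspace.\<close>

lemma finite_psd_form_subspace: "subspace V \<Longrightarrow> V \<subseteq> G \<Longrightarrow> finite_psd_form V B S"
  using psd_form_subspace finite_generators carrier_span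
  by (auto simp: finite_psd_form_def finite_psd_form_axioms_def)

lemma orthonormal_basis_exists: "\<exists>E. orthonormal_basis E"
proof -
  obtain E where E: "orthonormal E" "E \<subseteq> G"
    and max: "\<And>f. f \<in> G \<Longrightarrow> B f f = 1 \<Longrightarrow> \<exists>e\<in>E. B f e \<noteq> 0"
    using maximal_orthonormal[OF order_refl carrier_span finite_generators] by blast
  have "B f f = 0" if f: "f \<in> G" and 0: "\<forall>e\<in>E. B f e = 0" for f
  proof (rule ccontr)
    assume "B f f \<noteq> 0"
    then obtain e where "e \<in> E" "B ((1 / sqrt (B f f)) *\<^sub>R f) e \<noteq> 0"
      using max[OF _ normalize] f by blast
    then show False using 0 E f by (auto simp: scale_left)
  qed
  then show ?thesis using E by (auto simp: orthonormal_basis_def)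
qed

text \<open>The eigenvector maximizes the Rayleigh quotient: at a maximum with value \<open>c\<close> the form
  \<open>c B(f, g) - B(T f, g)\<close> is positive semidefinite and vanishes on the maximizer.\<close>

lemma eigenvector_exists:
  assumes T: "symmetric T" and f0: "f0 \<in> G" "B f0 f0 \<noteq> 0"
  obtains f c where "f \<in> G" "B f f = 1" "\<And>g. g \<in> G \<Longrightarrow> B (T f) g = c * B f g"
proof -
  obtain E where E: "orthonormal_basis E" using orthonormal_basis_exists by blast
  have on: "orthonormal E" and finE: "finite E" and EG: "E \<subseteq> G"
    using E by (auto simp: orthonormal_basis_def orthonormal_def)
  define F where "F x = (\<Sum>e\<in>E. x e *\<^sub>R e)" for x :: "'a \<Rightarrow> real"
  have FG [simp]: "F x \<in> G" for x using EG by (auto simp: F_def)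
  have TG: "T f \<in> G" if "f \<in> G" for f using T that by (rule symmetric_closed)
  \<comment> \<open>\<open>K\<close> is the unit sphere in coordinates along \<open>E\<close>.
    Coordinates are functions on the whole type; those outside \<open>E\<close> are pinned to 0, so
    that \<open>K\<close> is a closed part of a product of compact sets.\<close>
  define K where
    "K = (\<Pi>\<^sub>E e\<in>UNIV. if e \<in> E then {-1..1} else {0}) \<inter> {x :: 'a \<Rightarrow> real. (\<Sum>e\<in>E. (x e)\<^sup>2) = 1}"
  have cont: "continuous_on A (\<lambda>x :: 'a \<Rightarrow> real. x e)" for A e
    by (rule continuous_on_subset[OF continuous_on_product_coordinates]) simp
  have compact: "compact K"
    unfolding K_def
  proof (rule compact_Int_closed)
    have "compactin (product_topology (\<lambda>i. euclidean) UNIV)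
        (\<Pi>\<^sub>E e\<in>(UNIV :: 'a set). if e \<in> E then {-1..1::real} else {0})"
      by (subst compactin_PiE) auto
    then show "compact (\<Pi>\<^sub>E e\<in>(UNIV :: 'a set). if e \<in> E then {-1..1::real} else {0})"
      by (simp add: euclidean_product_topology)
    show "closed {x :: 'a \<Rightarrow> real. (\<Sum>e\<in>E. (x e)\<^sup>2) = 1}"
      by (intro closed_Collect_eq continuous_intros cont)
  qed
  have K_I: "(\<lambda>e. if e \<in> E then B g e else 0) \<in> K" if g: "g \<in> G" "B g g = 1" for g
  proof -
    have 1: "(\<Sum>e\<in>E. (B g e)\<^sup>2) = 1"
    proof -
      have "(\<Sum>e\<in>E. (B g e)\<^sup>2) = (\<Sum>e\<in>E. B g e * B e g)"
        using EG sym[OF g(1)] by (intro sum.cong refl) (auto simp: power2_eq_square)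
      then show ?thesis using Parseval[OF E g(1) g(1)] g(2) by simp
    qed
    have "(B g e)\<^sup>2 \<le> 1" if "e \<in> E" for e
      using member_le_sum[of e E "\<lambda>e. (B g e)\<^sup>2"] that finE 1 by simp
    then have "\<bar>B g e\<bar> \<le> 1" if "e \<in> E" for e
      using that by (simp only: abs_square_le_1)
    then have "- 1 \<le> B g e" "B g e \<le> 1" if "e \<in> E" for e
      using that by (force simp: abs_le_iff)+
    with 1 show ?thesis by (simp add: K_def PiE_UNIV_domain)
  qed
  have "K \<noteq> {}" using K_I[OF _ normalize] f0 by blast
  define q where "q x = B (T (F x)) (F x)" for x
  \<comment> \<open>Without linearity \<open>T (F x)\<close> cannot be expanded. Expanding the other
    factor first, moving \<open>T\<close> onto the basis vector and expanding again gives a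
    quadratic polynomial in the coordinates, hence continuity.\<close>
  have "q = (\<lambda>x. \<Sum>e\<in>E. x e * (\<Sum>e'\<in>E. x e' * B e' (T e)))"
  proof
    fix x
    have "q x = B (F x) (T (F x))" unfolding q_def using TG sym by simp
    also have "\<dots> = (\<Sum>e\<in>E. x e * B e (T (F x)))"
      unfolding F_def[of x] using EG TG[OF FG[of x]] by (subst lincomb_left) (auto simp: F_def)
    also have "\<dots> = (\<Sum>e\<in>E. x e * B (F x) (T e))"
    proof (intro sum.cong refl)
      fix e assume "e \<in> E"
      then have e: "e \<in> G" using EG by blast
      show "x e * B e (T (F x)) = x e * B (F x) (T e)"
        using symmetric_swap[OF T e FG[of x]] sym[OF TG[OF e] FG[of x]] by simp
    qed
    also have "\<dots> = (\<Sum>e\<in>E. x e * (\<Sum>e'\<in>E. x e' * B e' (T e)))"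
    proof (intro sum.cong refl)
      fix e assume "e \<in> E"
      then have "T e \<in> G" using EG TG by blast
      then have "B (F x) (T e) = (\<Sum>e'\<in>E. x e' * B e' (T e))"
        unfolding F_def using EG by (intro lincomb_left) auto
      then show "x e * B (F x) (T e) = x e * (\<Sum>e'\<in>E. x e' * B e' (T e))" by simp
    qed
    finally show "q x = (\<Sum>e\<in>E. x e * (\<Sum>e'\<in>E. x e' * B e' (T e)))" .
  qed
  moreover have "continuous_on K (\<lambda>x. \<Sum>e\<in>E. x e * (\<Sum>e'\<in>E. x e' * B e' (T e)))"
    by (intro continuous_intros cont)
  ultimately have "continuous_on K q" by simp
  then obtain x where x: "x \<in> K" and max: "\<And>y. y \<in> K \<Longrightarrow> q y \<le> q x"
    using continuous_attains_sup[OF compact \<open>K \<noteq> {}\<close>] by blast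
  define f c where "f = F x" and "c = q x"
  have fG: "f \<in> G" by (simp add: f_def)
  have "B f f = (\<Sum>e\<in>E. B f e * B e f)" using Parseval[OF E fG fG] .
  also have "\<dots> = (\<Sum>e\<in>E. (x e)\<^sup>2)"
    using orthonormal_coeff[OF on, of _ x] sym[OF _ fG] EG
    by (intro sum.cong refl) (auto simp: f_def F_def power2_eq_square)
  finally have ff: "B f f = 1" using x by (simp add: K_def)
  have unit: "B (T g) g \<le> c" if g: "g \<in> G" "B g g = 1" for g
  proof -
    define y where "y e = (if e \<in> E then B g e else 0)" for e
    \<comment> \<open>\<open>g\<close> and its Fourier sum \<open>F y\<close> differ by a null
      vector, so the maximum over \<open>K\<close> also bounds the quotient at
      \<open>g\<close>.\<close>
    have eqv: "B (F y) h = B g h" if "h \<in> G" for h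
    proof -
      have "B (F y) h = (\<Sum>e\<in>E. y e * B e h)"
        unfolding F_def using EG that by (intro lincomb_left) auto
      then show ?thesis using Parseval[OF E g(1) that] by (simp add: y_def)
    qed
    have "B (T g) g = B g (T g)" by (rule symmetric_swap[OF T g(1) g(1)])
    also have "\<dots> = B (F y) (T g)" using eqv[OF TG[OF g(1)]] by simp
    also have "\<dots> = B (T (F y)) g" using symmetric_swap[OF T FG g(1)] by simp
    also have "\<dots> = B (F y) (T (F y))" using eqv[OF TG[OF FG]] sym g TG FG by simp
    also have "\<dots> = q y" unfolding q_def using sym TG FG by simp
    also have "\<dots> \<le> c" unfolding c_def y_def by (intro max K_I g)
    finally show ?thesis .
  qed
  define R where "R g = c *\<^sub>R g - T g" for g
  have RG: "R g \<in> G" if "g \<in> G" for g using TG that by (auto simp: R_def)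
  have R: "symmetric R"
    unfolding symmetric_def using TG symmetric_swap[OF T]
    by (auto simp: R_def diff_left diff_right scale_left scale_right)
  \<comment> \<open>Unit vectors are covered by \<open>unit\<close>, and scaling reaches the other
    non-null vectors. Null vectors cannot be normalized; on them the form is zero.\<close>
  have "0 \<le> B (R g) g" if g: "g \<in> G" for g
  proof (cases "B g g = 0")
    case True
    then have "B g (T g) = 0" using null_left g TG by blast
    then show ?thesis using True g TG symmetric_swap[OF T g g]
      by (simp add: R_def diff_left scale_left)
  next
    case False
    define s where "s = 1 / sqrt (B g g)"
    have "B (T (s *\<^sub>R g)) (s *\<^sub>R g) \<le> c"
      unfolding s_def using g False by (intro unit normalize) auto
    moreover have "B (T (s *\<^sub>R g)) (s *\<^sub>R g) = s\<^sup>2 * B (T g) g"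
      using TG g symmetric_swap[OF T, of "s *\<^sub>R g" g] symmetric_swap[OF T g g]
      by (simp add: scale_left scale_right power2_eq_square)
    moreover have "s\<^sup>2 = 1 / B g g" using nonneg[OF g] by (simp add: s_def power_divide)
    ultimately have "B (T g) g \<le> c * B g g"
      using False nonneg[OF g] by (simp add: field_simps)
    then show ?thesis using g TG by (simp add: R_def diff_left scale_left)
  qed
  then interpret Q: psd_form G "\<lambda>f g. B (R f) g" by (rule psd_form_operator[OF R])
  have "B (R f) f = 0"
    using fG TG ff by (simp add: R_def diff_left scale_left) (simp add: c_def q_def f_def)
  then have "B (R f) g = 0" if "g \<in> G" for g using Q.null_left[OF fG that] by simp
  then have "B (T f) g = c * B f g" if "g \<in> G" for g
    using that fG TG by (simp add: R_def diff_left scale_left)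
  then show ?thesis using that fG ff by blast
qed

text \<open>Induction on \<open>I\<close>: inside the invariant space found so far, the eigenspace
  of the next operator is again invariant, since the operators commute. Keeping \<open>J\<close>
  apart from \<open>I\<close> preserves invariance under the operators still to come.\<close>

lemma common_eigenspace:
  assumes "finite I" "I \<subseteq> J"
    and T: "\<And>i. i \<in> J \<Longrightarrow> symmetric (T i)"
    and comm: "\<And>i j f g. i \<in> J \<Longrightarrow> j \<in> J \<Longrightarrow> f \<in> G \<Longrightarrow> g \<in> G \<Longrightarrow>
      B (T i (T j f)) g = B (T j (T i f)) g"
    and V: "subspace V" "V \<subseteq> G" "\<And>i f. i \<in> J \<Longrightarrow> f \<in> V \<Longrightarrow> T i f \<in> V" "\<exists>f\<in>V. B f f \<noteq> 0"
  shows "\<exists>W\<subseteq>V. subspace W \<and> (\<forall>i\<in>J. \<forall>f\<in>W. T i f \<in> W) \<and> (\<exists>f\<in>W. B f f \<noteq> 0) \<and>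
    (\<forall>i\<in>I. \<exists>c. \<forall>f\<in>W. \<forall>g\<in>G. B (T i f) g = c * B f g)"
  using assms(1,2)
proof (induction I rule: finite_induct)
  case empty
  then show ?case using V by (intro exI[of _ V]) auto
next
  case (insert i I)
  then obtain W where W: "W \<subseteq> V" "subspace W" "\<forall>i\<in>J. \<forall>f\<in>W. T i f \<in> W" "\<exists>f\<in>W. B f f \<noteq> 0"
    and eig: "\<forall>i\<in>I. \<exists>c. \<forall>f\<in>W. \<forall>g\<in>G. B (T i f) g = c * B f g"
    by auto
  have i: "i \<in> J" using insert.prems by simp
  have WG: "W \<subseteq> G" using W V by auto
  interpret W: finite_psd_form W B S by (rule finite_psd_form_subspace[OF W(2) WG])
  have "W.symmetric (T i)"
    using W WG T[OF i] i by (auto simp: W.symmetric_def symmetric_swap subset_iff)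
  then obtain f0 c where f0: "f0 \<in> W" "B f0 f0 = 1" "\<And>g. g \<in> W \<Longrightarrow> B (T i f0) g = c * B f0 g"
    using W.eigenvector_exists W(4) by blast
  define W' where "W' = {f\<in>W. \<forall>g\<in>G. B (T i f) g = c * B f g}"
  \<comment> \<open>So far the eigenvalue equation is tested only against \<open>W\<close>. The
    defect \<open>r\<close> lies in \<open>W\<close> itself, hence is null, hence orthogonal to all
    of \<open>G\<close>.\<close>
  have "B (T i f0) g = c * B f0 g" if g: "g \<in> G" for g
  proof -
    define r where "r = T i f0 - c *\<^sub>R f0"
    have TW: "T i f0 \<in> W" using W i f0 by blast
    then have rW: "r \<in> W" using f0 by (auto simp: r_def)
    have "B r r = 0"
      using f0(3)[OF rW] TW f0(1) rW W.diff_left[of "T i f0" "c *\<^sub>R f0" r] W.scale_left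
      by (simp add: r_def)
    then have "B r g = 0" using null_left rW WG g by blast
    then show ?thesis
      using TW f0 WG g by (auto simp: r_def diff_left scale_left subset_iff)
  qed
  then have f0': "f0 \<in> W'" using f0 by (simp add: W'_def)
  have "subspace W'"
    unfolding subspace_def
  proof (intro conjI ballI allI)
    have TG: "T i g \<in> G" if "g \<in> G" for g using symmetric_closed[OF T[OF i] that] .
    have swap: "B (T i f) g = B f (T i g)" if "f \<in> G" "g \<in> G" for f g
      using symmetric_swap[OF T[OF i] that] .
    show "0 \<in> W'"
      using W(2) by (auto simp: W'_def swap TG zero_left subspace_0)
    fix f assume f: "f \<in> W'"
    then have fG: "f \<in> G" using WG by (auto simp: W'_def)
    show "a *\<^sub>R f \<in> W'" for a
      using f fG by (auto simp: W'_def swap TG scale_left)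
    fix g assume g: "g \<in> W'"
    then have "g \<in> G" using WG by (auto simp: W'_def)
    then show "f + g \<in> W'"
      using f g fG by (auto simp: W'_def swap TG add_left algebra_simps)
  qed
  moreover have "T j f \<in> W'" if j: "j \<in> J" and f: "f \<in> W'" for j f
  proof -
    have fW: "f \<in> W" and fG: "f \<in> G" using f WG by (auto simp: W'_def)
    have "B (T i (T j f)) g = c * B (T j f) g" if g: "g \<in> G" for g
    proof -
      have Tg: "T j g \<in> G" using symmetric_closed[OF T[OF j] g] .
      have "B (T i (T j f)) g = B (T j (T i f)) g" using comm i j fG g by blast
      also have "\<dots> = B (T i f) (T j g)"
        using symmetric_swap[OF T[OF j] _ g] symmetric_closed[OF T[OF i] fG] by blast
      also have "\<dots> = c * B f (T j g)" using f Tg by (simp add: W'_def)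
      also have "\<dots> = c * B (T j f) g" using symmetric_swap[OF T[OF j] fG g] by simp
      finally show ?thesis .
    qed
    then show ?thesis using W(3) j fW by (simp add: W'_def)
  qed
  moreover have "\<exists>f\<in>W'. B f f \<noteq> 0" using f0' f0(2) by force
  moreover have "\<forall>k\<in>insert i I. \<exists>c. \<forall>f\<in>W'. \<forall>g\<in>G. B (T k f) g = c * B f g"
  proof
    fix k assume "k \<in> insert i I"
    then consider "k = i" | "k \<in> I" by blast
    then show "\<exists>c. \<forall>f\<in>W'. \<forall>g\<in>G. B (T k f) g = c * B f g"
      unfolding W'_def using eig by cases blast+
  qed
  moreover have "W' \<subseteq> V" using W(1) by (auto simp: W'_def)
  ultimately show ?case by (intro exI[of _ W'] conjI ballI) blast+
qed

text \<open>Take a maximal orthonormal set \<open>E\<close> of common eigenvectors. Its orthogonal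
  complement \<open>V\<close> is invariant by symmetry; a non-null vector in \<open>V\<close> would
  yield a further common eigenvector there, against maximality.\<close>

theorem simultaneous_diagonalization:
  assumes "finite I"
    and T: "\<And>i. i \<in> I \<Longrightarrow> symmetric (T i)"
    and comm: "\<And>i j f g. i \<in> I \<Longrightarrow> j \<in> I \<Longrightarrow> f \<in> G \<Longrightarrow> g \<in> G \<Longrightarrow>
      B (T i (T j f)) g = B (T j (T i f)) g"
  obtains E where "orthonormal_basis E"
    "\<And>e i. e \<in> E \<Longrightarrow> i \<in> I \<Longrightarrow> \<exists>c. \<forall>g\<in>G. B (T i e) g = c * B e g"
proof -
  define U where "U = {e\<in>G. \<forall>i\<in>I. \<exists>c. \<forall>g\<in>G. B (T i e) g = c * B e g}"
  have "U \<subseteq> G" "U \<subseteq> span S" using carrier_span by (auto simp: U_def)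
  from maximal_orthonormal[OF this finite_generators] obtain E where
    E: "orthonormal E" "E \<subseteq> U" and max: "\<And>f. f \<in> U \<Longrightarrow> B f f = 1 \<Longrightarrow> \<exists>e\<in>E. B f e \<noteq> 0"
    by blast
  have EG: "E \<subseteq> G" using E by (auto simp: U_def)
  define V where "V = {f\<in>G. \<forall>e\<in>E. B f e = 0}"
  have "B f f = 0" if "f \<in> V" for f
  proof (rule ccontr)
    assume nz: "B f f \<noteq> 0"
    have "subspace V"
      using EG by (auto simp: subspace_def V_def zero_left add_left scale_left subset_iff)
    moreover have "V \<subseteq> G" by (auto simp: V_def)
    moreover have "T i f \<in> V" if i: "i \<in> I" and f: "f \<in> V" for i f
    proof -
      have fG: "f \<in> G" using f by (simp add: V_def)
      have "B (T i f) e = 0" if e: "e \<in> E" for e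
      proof -
        have eG: "e \<in> G" using e EG by blast
        obtain c where "\<forall>g\<in>G. B (T i e) g = c * B e g" using e E(2) i unfolding U_def by blast
        then have "B (T i e) f = c * B e f" using fG by blast
        then show ?thesis
          using f e sym[of e f] fG eG sym[OF _ fG, of "T i e"] symmetric_closed[OF T[OF i] eG]
            symmetric_swap[OF T[OF i] fG eG]
          by (simp add: V_def)
      qed
      then show ?thesis using symmetric_closed[OF T[OF i] fG] by (simp add: V_def)
    qed
    moreover have "\<exists>f\<in>V. B f f \<noteq> 0" using nz \<open>f \<in> V\<close> by blast
    ultimately have "\<exists>W\<subseteq>V. subspace W \<and> (\<forall>i\<in>I. \<forall>f\<in>W. T i f \<in> W) \<and> (\<exists>f\<in>W. B f f \<noteq> 0) \<and>
        (\<forall>i\<in>I. \<exists>c. \<forall>f\<in>W. \<forall>g\<in>G. B (T i f) g = c * B f g)"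
      by (intro common_eigenspace[OF assms(1) order_refl T comm])
    then obtain W where "W \<subseteq> V" "subspace W" "\<exists>f\<in>W. B f f \<noteq> 0"
      and eig: "\<forall>i\<in>I. \<exists>c. \<forall>f\<in>W. \<forall>g\<in>G. B (T i f) g = c * B f g"
      by (elim exE conjE) rule
    then obtain h where h: "h \<in> W" "B h h \<noteq> 0" by blast
    define k where "k = (1 / sqrt (B h h)) *\<^sub>R h"
    have "h \<in> G" using h \<open>W \<subseteq> V\<close> \<open>V \<subseteq> G\<close> by blast
    then have "B k k = 1" unfolding k_def using h by (intro normalize)
    have "k \<in> W" using h \<open>subspace W\<close> by (simp add: k_def subspace_scale)
    then have "k \<in> V" using \<open>W \<subseteq> V\<close> by blast
    moreover have "k \<in> U" using eig \<open>k \<in> W\<close> \<open>k \<in> V\<close> by (auto simp: U_def V_def)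
    ultimately show False using max[OF _ \<open>B k k = 1\<close>] unfolding V_def by blast
  qed
  then have "orthonormal_basis E" using E(1) unfolding orthonormal_basis_def V_def by blast
  then show ?thesis using that E(2) unfolding U_def by blast
qed

end

section \<open>Weyl-symmetrized words\<close>

text \<open>With \<open>s = sqrt t\<close> the expression is the square of
  \<open>(k + 1) s^k\<close>, which tends to 0.\<close>

lemma square_poly_times_power_tendsto_0:
  fixes t :: real
  assumes "0 \<le> t" "t < 1"
  shows "(\<lambda>k. (real k + 1)\<^sup>2 * t ^ k) \<longlonglongrightarrow> 0"
proof -
  define s where "s = sqrt t"
  have s: "0 \<le> s" "s < 1" "s\<^sup>2 = t" using assms by (auto simp: s_def)
  have "(\<lambda>k. real k * s ^ k + s ^ k) \<longlonglongrightarrow> 0 + 0"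
    using s by (intro tendsto_add LIMSEQ_power_zero powser_times_n_limit_0) auto
  then have "(\<lambda>k. (real k * s ^ k + s ^ k)\<^sup>2) \<longlonglongrightarrow> 0\<^sup>2"
    by (intro tendsto_power) simp
  moreover have "(real k * s ^ k + s ^ k)\<^sup>2 = (real k + 1)\<^sup>2 * t ^ k" for k
  proof -
    have "real k * s ^ k + s ^ k = (real k + 1) * s ^ k" by (simp add: algebra_simps)
    then have "(real k * s ^ k + s ^ k)\<^sup>2 = (real k + 1)\<^sup>2 * (s ^ k)\<^sup>2"
      by (simp add: power_mult_distrib)
    also have "(s ^ k)\<^sup>2 = t ^ k" using s(3) by (metis power_mult mult.commute)
    finally show ?thesis .
  qed
  ultimately show ?thesis by simp
qed

context psd_form
begin

lemma funpow_closed: "symmetric T \<Longrightarrow> f \<in> G \<Longrightarrow> (T ^^ k) f \<in> G"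
  by (induction k) (auto simp: symmetric_closed)

lemma funpow_swap:
  assumes "symmetric T" "f \<in> G" "g \<in> G"
  shows "B ((T ^^ k) f) g = B f ((T ^^ k) g)"
  using assms(2,3)
proof (induction k arbitrary: g)
  case (Suc k)
  then have "B ((T ^^ Suc k) f) g = B ((T ^^ k) f) (T g)"
    using assms(1) by (simp add: symmetric_swap funpow_closed)
  also have "\<dots> = B f ((T ^^ Suc k) g)"
    using Suc symmetric_closed[OF assms(1)] by (simp add: funpow_swap1)
  finally show ?case .
qed simp

text \<open>\<open>T e\<close> equals \<open>c e\<close> only up to a null vector, so it is not
  rewritten under \<open>T\<close>; each factor is moved to the other argument first.\<close>

lemma funpow_eigenvector:
  assumes T: "symmetric T" and e: "e \<in> G" "\<And>g. g \<in> G \<Longrightarrow> B (T e) g = c * B e g" and g: "g \<in> G"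
  shows "B ((T ^^ k) e) g = c ^ k * B e g"
  using g
proof (induction k arbitrary: g)
  case (Suc k)
  have "B ((T ^^ Suc k) e) g = B ((T ^^ k) e) (T g)"
    using Suc T e by (simp add: symmetric_swap funpow_closed)
  also have "\<dots> = c ^ k * B (T e) g"
    using Suc T e by (simp add: symmetric_closed symmetric_swap)
  finally show ?case using e(2)[OF Suc.prems] by simp
qed simp

lemma weyl_word_closed:
  assumes "symmetric X" "symmetric Y" "f \<in> G"
  shows "weyl_word k X Y f \<in> G"
  using assms by (auto simp: weyl_word_def sum_fun_apply funpow_closed symmetric_closed)

text \<open>In each summand the inner power of \<open>X\<close> meets \<open>e\<close> and gives
  \<open>a ^ j\<close>, while the outer power, moved across, meets \<open>e'\<close> and gives
  \<open>b ^ (k - j)\<close>.\<close>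

lemma weyl_word_eigenvectors:
  assumes X: "symmetric X" and Y: "symmetric Y"
    and a: "e \<in> G" "\<And>g. g \<in> G \<Longrightarrow> B (X e) g = a * B e g"
    and b: "e' \<in> G" "\<And>g. g \<in> G \<Longrightarrow> B (X e') g = b * B e' g"
  shows "B (weyl_word k X Y e) e' = (\<Sum>j\<le>k. a ^ j * b ^ (k - j)) * B (Y e) e'"
proof -
  have YG: "Y f \<in> G" if "f \<in> G" for f using symmetric_closed[OF Y that] .
  have XG: "(X ^^ m) f \<in> G" if "f \<in> G" for f m using funpow_closed[OF X that] .
  have "B ((X ^^ (k - j)) (Y ((X ^^ j) e))) e' = a ^ j * b ^ (k - j) * B (Y e) e'" for j
  proof -
    have "B ((X ^^ (k - j)) (Y ((X ^^ j) e))) e' = B (Y ((X ^^ j) e)) ((X ^^ (k - j)) e')"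
      by (rule funpow_swap[OF X YG[OF XG[OF a(1)]] b(1)])
    also have "\<dots> = B ((X ^^ j) e) (Y ((X ^^ (k - j)) e'))"
      by (rule symmetric_swap[OF Y XG[OF a(1)] XG[OF b(1)]])
    also have "\<dots> = a ^ j * B e (Y ((X ^^ (k - j)) e'))"
      by (rule funpow_eigenvector[OF X a YG[OF XG[OF b(1)]]])
    also have "B e (Y ((X ^^ (k - j)) e')) = B (Y e) ((X ^^ (k - j)) e')"
      using symmetric_swap[OF Y a(1) XG[OF b(1)]] by simp
    also have "\<dots> = B ((X ^^ (k - j)) e') (Y e)"
      by (rule sym[OF YG[OF a(1)] XG[OF b(1)]])
    also have "\<dots> = b ^ (k - j) * B e' (Y e)"
      by (rule funpow_eigenvector[OF X b YG[OF a(1)]])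
    also have "B e' (Y e) = B (Y e) e'" by (rule sym[OF b(1) YG[OF a(1)]])
    finally show ?thesis by simp
  qed
  then have "(\<Sum>j\<le>k. B ((X ^^ (k - j)) (Y ((X ^^ j) e))) e') =
      (\<Sum>j\<le>k. a ^ j * b ^ (k - j)) * B (Y e) e'"
    by (simp add: sum_distrib_right)
  moreover have "B (weyl_word k X Y e) e' = (\<Sum>j\<le>k. B ((X ^^ (k - j)) (Y ((X ^^ j) e))) e')"
    unfolding weyl_word_def sum_fun_apply comp_def
    using XG YG a(1) b(1) by (intro sum_left) auto
  ultimately show ?thesis by simp
qed

text \<open>In an eigenbasis of \<open>X\<close>, the diagonal entries of \<open>C\<^sub>k\<^sub>,\<^sub>1(X, Y)\<close> at \<open>a > b\<close> grow like
  \<open>k a\<^sup>k\<close> and \<open>k b\<^sup>k\<close>, the off-diagonal one at least like \<open>a\<^sup>k\<close>. Positivity of the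
  \<open>2 \<times> 2\<close> minor for all \<open>k\<close> thus kills the off-diagonal entry of \<open>Y\<close>.\<close>

lemma weyl_psd_off_diagonal:
  assumes X: "symmetric X" and Y: "symmetric Y"
    and weyl_sym: "\<And>k. 1 \<le> k \<Longrightarrow> symmetric (weyl_word k X Y)"
    and weyl_nonneg: "\<And>k f. 1 \<le> k \<Longrightarrow> f \<in> G \<Longrightarrow> 0 \<le> B (weyl_word k X Y f) f"
    and a: "e \<in> G" "\<And>g. g \<in> G \<Longrightarrow> B (X e) g = a * B e g"
    and b: "e' \<in> G" "\<And>g. g \<in> G \<Longrightarrow> B (X e') g = b * B e' g"
    and ab: "0 \<le> b" "b < a"
  shows "B (Y e) e' = 0"
proof -
  define p where "p = B (Y e) e * B (Y e') e'"
  define y where "y = B (Y e) e'"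
  have bound: "y\<^sup>2 \<le> (real k + 1)\<^sup>2 * (b / a) ^ k * p" if k: "1 \<le> k" for k
  proof -
    interpret C: psd_form G "\<lambda>f g. B (weyl_word k X Y f) g"
      by (rule psd_form_operator[OF weyl_sym[OF k] weyl_nonneg[OF k]])
    define c where "c = (\<Sum>j\<le>k. a ^ j * b ^ (k - j))"
    have diag: "(\<Sum>j\<le>k. x ^ j * x ^ (k - j)) = (real k + 1) * x ^ k" for x :: real
      by (simp add: power_add[symmetric] add.commute)
    \<comment> \<open>The summand \<open>j = k\<close> alone is \<open>a ^ k\<close>; the others are
      nonnegative.\<close>
    have "a ^ k \<le> c"
      using member_le_sum[of k "{..k}" "\<lambda>j. a ^ j * b ^ (k - j)"] ab by (simp add: c_def)
    then have "(a ^ k)\<^sup>2 * y\<^sup>2 \<le> c\<^sup>2 * y\<^sup>2"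
      using ab by (intro mult_right_mono power_mono) auto
    also have "\<dots> = (B (weyl_word k X Y e) e')\<^sup>2"
      by (simp add: weyl_word_eigenvectors[OF X Y a b] c_def y_def power_mult_distrib)
    also have "\<dots> \<le> B (weyl_word k X Y e) e * B (weyl_word k X Y e') e'"
      by (rule C.Cauchy_Schwarz[OF a(1) b(1)])
    also have "\<dots> = (real k + 1)\<^sup>2 * (a ^ k * b ^ k) * p"
      by (simp add: weyl_word_eigenvectors[OF X Y a a] weyl_word_eigenvectors[OF X Y b b]
          diag p_def power2_eq_square)
    finally have "(a ^ k)\<^sup>2 * y\<^sup>2 \<le> (real k + 1)\<^sup>2 * (a ^ k * b ^ k) * p" .
    \<comment> \<open>One positive factor \<open>a ^ k\<close> is split off for cancellation;
      dividing by the other produces the ratio \<open>b / a < 1\<close>.\<close>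
    then have "a ^ k * (a ^ k * y\<^sup>2) \<le> a ^ k * ((real k + 1)\<^sup>2 * b ^ k * p)"
      by (simp only: power2_eq_square mult.assoc mult.left_commute)
    then have "a ^ k * y\<^sup>2 \<le> (real k + 1)\<^sup>2 * b ^ k * p"
      using ab by simp
    then have "y\<^sup>2 \<le> (real k + 1)\<^sup>2 * b ^ k * p / a ^ k"
      using ab by (simp add: pos_le_divide_eq mult.commute)
    then show ?thesis by (simp add: power_divide)
  qed
  have "(\<lambda>k. (real k + 1)\<^sup>2 * (b / a) ^ k * p) \<longlonglongrightarrow> 0 * p"
    using ab by (intro tendsto_mult_right square_poly_times_power_tendsto_0) auto
  then have "y\<^sup>2 \<le> 0 * p"
    by (rule tendsto_lowerbound) (auto intro!: eventually_sequentiallyI[of 1] bound)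
  then show ?thesis by (simp add: y_def)
qed

end

context finite_psd_form
begin

text \<open>In an eigenbasis of \<open>X\<close>, whose eigenvalues are nonnegative, the entries of
  \<open>Y\<close> between distinct eigenvalues vanish. The entries of \<open>X Y\<close> and
  \<open>Y X\<close> are those of \<open>Y\<close> times the eigenvalue of one or the other basis
  vector, so they agree.\<close>

theorem weyl_psd_commute:
  assumes X: "symmetric X" and Y: "symmetric Y"
    and X_nonneg: "\<And>f. f \<in> G \<Longrightarrow> 0 \<le> B (X f) f"
    and weyl_sym: "\<And>k. 1 \<le> k \<Longrightarrow> symmetric (weyl_word k X Y)"
    and weyl_nonneg: "\<And>k f. 1 \<le> k \<Longrightarrow> f \<in> G \<Longrightarrow> 0 \<le> B (weyl_word k X Y f) f"
    and fg: "f \<in> G" "g \<in> G"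
  shows "B (X (Y f)) g = B (Y (X f)) g"
proof -
  have XG: "X f \<in> G" and YG: "Y f \<in> G" if "f \<in> G" for f
    using symmetric_closed X Y that by auto
  obtain E where E: "orthonormal_basis E"
    \<comment> \<open>A one-element family turns simultaneous diagonalization into the spectral
      theorem for \<open>X\<close>.\<close>
    and eig: "\<And>e i. e \<in> E \<Longrightarrow> i \<in> {()} \<Longrightarrow> \<exists>c. \<forall>g\<in>G. B (X e) g = c * B e g"
    using simultaneous_diagonalization[of "{()}" "\<lambda>_. X"] X by blast
  have on: "orthonormal E" and EG: "E \<subseteq> G"
    using E by (auto simp: orthonormal_basis_def orthonormal_def)
  define c where "c e = B (X e) e" for e
  have c: "B (X e) g = c e * B e g" if e: "e \<in> E" and g: "g \<in> G" for e g
  proof -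
    obtain c' where c': "\<forall>g\<in>G. B (X e) g = c' * B e g"
      using eig[OF e, of "()"] by blast
    moreover have "B e e = 1" using on e by (simp add: orthonormal_def)
    ultimately have "c' = c e" using e EG by (auto simp: c_def)
    then show ?thesis using c' g by simp
  qed
  have c_nonneg: "0 \<le> c e" if "e \<in> E" for e
    using X_nonneg EG that by (auto simp: c_def)
  have off: "c e' * B (Y e) e' = c e * B (Y e) e'" if e: "e \<in> E" "e' \<in> E" for e e'
  proof -
    have G: "e \<in> G" "e' \<in> G" using e EG by auto
    consider "c e = c e'" | "c e' < c e" | "c e < c e'" by linarith
    then show ?thesis
    proof cases
      case 2
      have "B (Y e) e' = 0"
        by (rule weyl_psd_off_diagonal[OF X Y weyl_sym weyl_nonneg
              G(1) c[OF e(1)] G(2) c[OF e(2)] c_nonneg[OF e(2)] 2])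
      then show ?thesis by simp
    next
      case 3
      have "B (Y e') e = 0"
        by (rule weyl_psd_off_diagonal[OF X Y weyl_sym weyl_nonneg
              G(2) c[OF e(2)] G(1) c[OF e(1)] c_nonneg[OF e(1)] 3])
      then have "B (Y e) e' = 0"
        using symmetric_swap[OF Y G] sym[OF G(1) YG[OF G(2)]] by simp
      then show ?thesis by simp
    qed simp
  qed
  have basis: "B (X (Y e)) e' = B (Y (X e)) e'" if e: "e \<in> E" "e' \<in> E" for e e'
  proof -
    have G: "e \<in> G" "e' \<in> G" using e EG by auto
    have "B (X (Y e)) e' = B (X e') (Y e)"
      using symmetric_swap[OF X YG[OF G(1)] G(2)] sym[OF YG[OF G(1)] XG[OF G(2)]] by simp
    also have "\<dots> = c e' * B (Y e) e'"
      using c[OF e(2) YG[OF G(1)]] sym[OF G(2) YG[OF G(1)]] by simp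
    also have "\<dots> = c e * B (Y e) e'" by (rule off[OF e])
    also have "\<dots> = B (X e) (Y e')"
      using c[OF e(1) YG[OF G(2)]] symmetric_swap[OF Y G] by simp
    also have "\<dots> = B (Y (X e)) e'" using symmetric_swap[OF Y XG[OF G(1)] G(2)] by simp
    finally show ?thesis .
  qed
  \<comment> \<open>Parseval passes from basis vectors to arbitrary ones, one argument at a time:
    here in \<open>g\<close>, and below in \<open>f\<close> after the operators have been moved off
    it.\<close>
  have one: "B (X (Y e)) g = B (Y (X e)) g" if e: "e \<in> E" and g: "g \<in> G" for e g
  proof -
    have eG: "e \<in> G" using e EG by auto
    have "B (X (Y e)) g = B g (X (Y e))" "B (Y (X e)) g = B g (Y (X e))"
      using sym XG YG eG g by auto
    moreover have "B g (X (Y e)) = (\<Sum>e'\<in>E. B g e' * B e' (X (Y e)))"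
      by (rule Parseval[OF E g XG[OF YG[OF eG]]])
    moreover have "B g (Y (X e)) = (\<Sum>e'\<in>E. B g e' * B e' (Y (X e)))"
      by (rule Parseval[OF E g YG[OF XG[OF eG]]])
    moreover have "B e' (X (Y e)) = B e' (Y (X e))" if "e' \<in> E" for e'
    proof -
      have "e' \<in> G" using that EG by blast
      then show ?thesis
        using basis[OF e that] sym[OF XG[OF YG[OF eG]]] sym[OF YG[OF XG[OF eG]]] by simp
    qed
    ultimately show ?thesis by simp
  qed
  have "B (X (Y f)) g = B f (Y (X g))"
    using symmetric_swap[OF X YG[OF fg(1)] fg(2)] symmetric_swap[OF Y fg(1) XG[OF fg(2)]] by simp
  also have "\<dots> = (\<Sum>e\<in>E. B f e * B e (Y (X g)))"
    by (rule Parseval[OF E fg(1) YG[OF XG[OF fg(2)]]])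
  also have "\<dots> = (\<Sum>e\<in>E. B f e * B e (X (Y g)))"
  proof (intro sum.cong refl)
    fix e assume e: "e \<in> E"
    then have eG: "e \<in> G" using EG by blast
    have "B e (Y (X g)) = B (X (Y e)) g"
      using symmetric_swap[OF X YG[OF eG] fg(2)] symmetric_swap[OF Y eG XG[OF fg(2)]] by simp
    also have "\<dots> = B (Y (X e)) g" by (rule one[OF e fg(2)])
    also have "\<dots> = B e (X (Y g))"
      using symmetric_swap[OF Y XG[OF eG] fg(2)] symmetric_swap[OF X eG YG[OF fg(2)]] by simp
    finally show "B f e * B e (Y (X g)) = B f e * B e (X (Y g))" by simp
  qed
  also have "\<dots> = B f (X (Y g))"
    by (rule Parseval[OF E fg(1) XG[OF YG[OF fg(2)]], symmetric])
  also have "\<dots> = B (Y (X f)) g"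
    using symmetric_swap[OF Y XG[OF fg(1)] fg(2)] symmetric_swap[OF X fg(1) YG[OF fg(2)]] by simp
  finally show ?thesis .
qed

end

section \<open>Bounded functions in \<open>L\<^sup>2\<close>\<close>

text \<open>On a finite measure space, products of such functions are integrable. The class will
  contain all generators of \<open>H_space\<close> as well as the coordinate multiples of functions
  in \<open>L_space\<close>.\<close>

definition bounded_measurable :: "'a measure \<Rightarrow> ('a \<Rightarrow> real) set"
  where "bounded_measurable M =
    {f \<in> borel_measurable M. \<exists>C. \<forall>x\<in>space M. \<bar>f x\<bar> \<le> C}"

lemma bounded_measurable_mult:
  assumes "f \<in> bounded_measurable M" "g \<in> bounded_measurable M"
  shows "(\<lambda>x. f x * g x) \<in> bounded_measurable M"
proof -
  obtain C D where C: "\<forall>x\<in>space M. \<bar>f x\<bar> \<le> C" and D: "\<forall>x\<in>space M. \<bar>g x\<bar> \<le> D"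
    using assms by (auto simp: bounded_measurable_def)
  have "\<bar>f x * g x\<bar> \<le> \<bar>C\<bar> * \<bar>D\<bar>" if "x \<in> space M" for x
    using C D that unfolding abs_mult by (intro mult_mono) (auto intro: order_trans[OF _ abs_ge_self])
  then show ?thesis using assms by (auto simp: bounded_measurable_def)
qed

lemma subspace_bounded_measurable: "subspace (bounded_measurable M)"
  unfolding subspace_def
proof (intro conjI ballI allI)
  show "0 \<in> bounded_measurable M"
    by (auto simp: bounded_measurable_def zero_fun_def intro: exI[of _ 0])
  fix f assume f: "f \<in> bounded_measurable M"
  obtain C where C: "\<forall>x\<in>space M. \<bar>f x\<bar> \<le> C" using f by (auto simp: bounded_measurable_def)
  show "c *\<^sub>R f \<in> bounded_measurable M" for c
  proof -
    have "(\<lambda>x. c) \<in> bounded_measurable M" by (auto simp: bounded_measurable_def)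
    from bounded_measurable_mult[OF this f] show ?thesis by (simp add: scaleR_fun_def)
  qed
  fix g assume g: "g \<in> bounded_measurable M"
  obtain D where D: "\<forall>x\<in>space M. \<bar>g x\<bar> \<le> D" using g by (auto simp: bounded_measurable_def)
  have "\<bar>f x + g x\<bar> \<le> C + D" if "x \<in> space M" for x
    using C D that by (meson abs_triangle_ineq add_mono order_trans)
  then show "f + g \<in> bounded_measurable M"
    using f g by (auto simp: bounded_measurable_def plus_fun_def)
qed

context finite_measure
begin

lemma integrable_bounded_measurable:
  assumes "f \<in> bounded_measurable M"
  shows "integrable M f"
proof -
  obtain C where "\<forall>x\<in>space M. \<bar>f x\<bar> \<le> C" using assms by (auto simp: bounded_measurable_def)
  then show ?thesis
    using assms by (intro integrable_const_bound[of _ C]) (auto simp: bounded_measurable_def)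
qed

lemma integrable_mult_bounded_measurable:
  "f \<in> bounded_measurable M \<Longrightarrow> g \<in> bounded_measurable M \<Longrightarrow> integrable M (\<lambda>x. f x * g x)"
  by (intro integrable_bounded_measurable bounded_measurable_mult)

lemma psd_form_L2: "psd_form (bounded_measurable M) (L2_inner M)"
proof
  fix f g h assume "f \<in> bounded_measurable M" "g \<in> bounded_measurable M" "h \<in> bounded_measurable M"
  then show "L2_inner M (f + g) h = L2_inner M f h + L2_inner M g h"
    by (simp add: L2_inner_def distrib_right integrable_mult_bounded_measurable)
qed (auto simp: subspace_bounded_measurable L2_inner_def scaleR_fun_def mult.assoc
    intro: Bochner_Integration.integral_cong)

text \<open>The nonnegative function \<open>f\<^sup>2\<close> has integral zero. This translates
  null vectors back into almost-everywhere statements.\<close>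

lemma L2_null_AE:
  assumes "f \<in> bounded_measurable M" "L2_inner M f f = 0"
  shows "AE x in M. f x = 0"
  using assms integral_nonneg_eq_0_iff_AE[OF integrable_mult_bounded_measurable[OF assms(1,1)]]
  by (simp add: L2_inner_def)

end

lemma L2_inner_AE_zero: "AE x in M. f x = 0 \<Longrightarrow> L2_inner M f g = 0"
  unfolding L2_inner_def by (rule integral_eq_zero_AE) auto

section \<open>Orthogonal projection and dimension in L2\<close>

locale finite_L2 = finite_measure M for M :: "'a measure" +
  fixes V :: "('a \<Rightarrow> real) set" and S
  assumes V_span: "V = span S" and finite_S: "finite S" and S_bounded: "S \<subseteq> bounded_measurable M"
begin

lemma V_bounded: "V \<subseteq> bounded_measurable M"
  unfolding V_span using S_bounded subspace_bounded_measurable by (rule span_minimal)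

text \<open>Two instances of the form are in play: \<open>big\<close> accommodates functions still
  to be projected, the unprefixed one lives on \<open>V\<close>.\<close>

sublocale big: psd_form "bounded_measurable M" "L2_inner M"
  by (rule psd_form_L2)

sublocale finite_psd_form V "L2_inner M" S
proof -
  interpret V: psd_form V "L2_inner M"
    by (rule big.psd_form_subspace[OF _ V_bounded]) (simp add: V_span)
  show "finite_psd_form V (L2_inner M) S"
    by unfold_locales (auto simp: V_span finite_S)
qed

text \<open>The Fourier sum of \<open>f\<close> along an orthonormal basis of \<open>V\<close> is a
  witness for the choice in \<open>L2_proj\<close>.\<close>

lemma L2_proj:
  assumes f: "f \<in> bounded_measurable M"
  shows "L2_proj M V f \<in> V" and "g \<in> V \<Longrightarrow> L2_inner M (f - L2_proj M V f) g = 0"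
proof -
  obtain E where E: "orthonormal_basis E" using orthonormal_basis_exists by blast
  have on: "orthonormal E" and EV: "E \<subseteq> V"
    using E by (auto simp: orthonormal_basis_def orthonormal_def)
  define p where "p = (\<Sum>e\<in>E. L2_inner M f e *\<^sub>R e)"
  have p: "p \<in> V" using EV by (auto simp: p_def)
  have "L2_inner M (f - p) g = 0" if g: "g \<in> V" for g
  proof -
    have gM: "g \<in> bounded_measurable M" and pM: "p \<in> bounded_measurable M"
      and EM: "E \<subseteq> bounded_measurable M"
      using g p EV V_bounded by auto
    \<comment> \<open>\<open>E\<close> spans \<open>V\<close> only up to null vectors, so
      orthogonality is shown for the Fourier sum \<open>q\<close> of \<open>g\<close>;
      \<open>g - q\<close> is null, hence orthogonal also to bounded functions outside
      \<open>V\<close>.\<close>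
    define q where "q = (\<Sum>e\<in>E. L2_inner M g e *\<^sub>R e)"
    have qV: "q \<in> V" using EV by (auto simp: q_def)
    have qM: "q \<in> bounded_measurable M" using qV V_bounded by auto
    have null: "L2_inner M (g - q) h = 0" if "h \<in> bounded_measurable M" for h
      using big.null_left[OF _ that] basis_residual[OF E g] gM qM by (auto simp: q_def)
    have fp: "f - p \<in> bounded_measurable M" using f pM by auto
    have "L2_inner M e (f - p) = 0" if e: "e \<in> E" for e
      using orthonormal_coeff[OF on e, of "L2_inner M f"] e EM f pM fp big.sym[of e "f - p"]
        big.diff_left[of f p e] by (auto simp: p_def)
    then have "L2_inner M q (f - p) = 0"
      unfolding q_def using EM fp by (subst big.lincomb_left) auto
    then have "L2_inner M g (f - p) = 0"
      using null[OF fp] big.diff_left[OF gM qM fp] by simp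
    then show ?thesis using big.sym[OF fp gM] by simp
  qed
  then have "\<exists>p. p \<in> V \<and> (\<forall>g\<in>V. L2_inner M (f - p) g = 0)" using p by blast
  from someI_ex[OF this]
  have "L2_proj M V f \<in> V \<and> (\<forall>g\<in>V. L2_inner M (f - L2_proj M V f) g = 0)"
    unfolding L2_proj_def .
  then show "L2_proj M V f \<in> V" and "g \<in> V \<Longrightarrow> L2_inner M (f - L2_proj M V f) g = 0"
    by blast+
qed

lemma L2_inner_proj:
  assumes "f \<in> bounded_measurable M" "g \<in> V"
  shows "L2_inner M (L2_proj M V f) g = L2_inner M f g"
proof -
  have "L2_proj M V f \<in> bounded_measurable M" "g \<in> bounded_measurable M"
    using L2_proj(1)[OF assms(1)] assms(2) V_bounded by auto
  from big.diff_left[OF assms(1) this] show ?thesis using L2_proj(2)[OF assms] by simp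
qed

text \<open>\<open>E\<close> itself is independent. Conversely, replacing the members of an
  independent \<open>D\<close> by their Fourier sums along \<open>E\<close> changes them by null
  functions only, so independence almost everywhere becomes linear independence inside
  \<open>span E\<close>.\<close>

lemma L2_dim_orthonormal_basis:
  assumes E: "orthonormal_basis E"
  shows "L2_dim M V = card E"
proof -
  have on: "orthonormal E" and EV: "E \<subseteq> V" and finE: "finite E"
    using E by (auto simp: orthonormal_basis_def orthonormal_def)
  have lin: "(\<lambda>x. \<Sum>b\<in>D. c b * b x) = (\<Sum>b\<in>D. c b *\<^sub>R b)" for c and D :: "('a \<Rightarrow> real) set"
    by (simp add: fun_eq_iff sum_fun_apply scaleR_fun_def)
  have "L2_independent M E"
    unfolding L2_independent_def
  proof (intro allI impI ballI)
    fix c e assume "AE x in M. (\<Sum>b\<in>E. c b * b x) = 0" and e: "e \<in> E"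
    then have "L2_inner M (\<lambda>x. \<Sum>b\<in>E. c b * b x) e = 0" by (intro L2_inner_AE_zero)
    then show "c e = 0" using orthonormal_coeff[OF on e, of c] by (simp add: lin)
  qed
  moreover have "card D \<le> card E" if D: "D \<subseteq> V" "finite D" "L2_independent M D" for D
  proof -
    define h where "h f = (\<Sum>e\<in>E. L2_inner M f e *\<^sub>R e)" for f
    have hV: "h f \<in> V" for f using EV by (auto simp: h_def)
    have h_inner: "L2_inner M (h f) g = L2_inner M f g" if "f \<in> V" "g \<in> V" for f g
      unfolding h_def Parseval[OF E that] using EV that by (intro lincomb_left) auto
    have indep: "\<forall>b\<in>D. c b = 0" if 0: "(\<Sum>b\<in>D. c b *\<^sub>R h b) = 0" for c
    proof -
      define s where "s = (\<Sum>b\<in>D. c b *\<^sub>R b)"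
      have sV: "s \<in> V" using D by (auto simp: s_def)
      have "L2_inner M s s = (\<Sum>b\<in>D. c b * L2_inner M b s)"
        using D sV lincomb_left[of D "\<lambda>b. b" s c] by (auto simp: s_def[symmetric])
      also have "\<dots> = (\<Sum>b\<in>D. c b * L2_inner M (h b) s)"
        using D sV h_inner by (intro sum.cong) auto
      also have "\<dots> = L2_inner M (\<Sum>b\<in>D. c b *\<^sub>R h b) s"
        using hV sV by (subst lincomb_left) auto
      also have "\<dots> = 0" using 0 sV zero_left by simp
      finally have "AE x in M. s x = 0" using sV V_bounded by (intro L2_null_AE) auto
      then have "AE x in M. (\<Sum>b\<in>D. c b * b x) = 0" by (simp only: s_def lin[symmetric])
      then show ?thesis using D(3) unfolding L2_independent_def by blast
    qed
    have inj: "inj_on h D"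
    proof (rule inj_onI, rule ccontr)
      fix b b' assume b: "b \<in> D" "b' \<in> D" "h b = h b'" "b \<noteq> b'"
      \<comment> \<open>A collision of \<open>h\<close> would be the nontrivial relation
        \<open>h b - h b' = 0\<close>.\<close>
      let ?c = "\<lambda>d. if d = b then 1 else if d = b' then - 1 else (0::real)"
      have "(\<Sum>d\<in>D. ?c d *\<^sub>R h d) = (\<Sum>d\<in>{b, b'}. ?c d *\<^sub>R h d)"
        using b D(2) by (intro sum.mono_neutral_right) auto
      also have "\<dots> = 0" using b by simp
      finally show False using indep[of ?c] b by auto
    qed
    have "u b = 0" if "(\<Sum>v\<in>h ` D. u v *\<^sub>R v) = 0" "b \<in> h ` D" for u b
      using indep[of "u \<circ> h"] that by (auto simp: sum.reindex[OF inj])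
    then have "independent (h ` D)" using D(2) by (auto simp: dependent_finite)
    moreover have "h ` D \<subseteq> span E"
      unfolding h_def by (intro image_subsetI span_sum span_scale span_base)
    ultimately have "card (h ` D) \<le> card E" using independent_span_bound[OF finE] by blast
    then show ?thesis by (simp add: card_image[OF inj])
  qed
  ultimately show ?thesis
    unfolding L2_dim_def using EV finE by (intro Greatest_equality) auto
qed

end

section \<open>The truncated multiplication operators\<close>

text \<open>A ball of radius \<open>r\<close> about \<open>l\<close> lies in \<Gamma>. Pair
  \<open>x\<close> with the point of that ball farthest in the direction of
  \<open>- x\<close>.\<close>

lemma dual_cone_norm_bound:
  assumes "l \<in> interior \<Gamma>"
  obtains r where "0 < r" "\<And>x. x \<in> dual_cone \<Gamma> \<Longrightarrow> r * norm x \<le> l \<bullet> x"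
proof -
  obtain r where r: "0 < r" "cball l r \<subseteq> \<Gamma>" using assms by (auto simp: mem_interior_cball)
  have "r * norm x \<le> l \<bullet> x" if x: "x \<in> dual_cone \<Gamma>" for x
  proof (cases "x = 0")
    case False
    have "l - (r / norm x) *\<^sub>R x \<in> cball l r" using r(1) False by (simp add: dist_norm)
    then have "l - (r / norm x) *\<^sub>R x \<in> \<Gamma>" using r(2) by blast
    then have "0 \<le> x \<bullet> (l - (r / norm x) *\<^sub>R x)" using x unfolding dual_cone_def by blast
    also have "\<dots> = l \<bullet> x - r * norm x"
      using False by (simp add: inner_diff_right inner_commute[of x l] power2_norm_eq_inner[symmetric]
          power2_eq_square)
    finally show ?thesis by simp
  qed simp
  then show ?thesis using that r by blast
qed

text \<open>With \<open>t = 1 + l \<bullet> x\<close> every coordinate is at most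
  \<open>t / r\<close> in absolute value, so the numerator is absorbed by as many factors
  \<open>t\<close> as its degree. The remaining \<open>t ^ j\<close> is kept to absorb one more
  coordinate later.\<close>

lemma frac_monom_bound:
  assumes r: "0 < r" "r * norm x \<le> l \<bullet> x"
  shows "\<bar>frac_monom l \<alpha> j x\<bar> \<le> (1 / r) ^ sum \<alpha> UNIV / (1 + l \<bullet> x) ^ j"
proof -
  define t where "t = 1 + l \<bullet> x"
  have "0 \<le> r * norm x" using r by simp
  then have t: "1 \<le> t" using r unfolding t_def by linarith
  have "\<bar>x $ i\<bar> \<le> t / r" for i
  proof -
    have "r * \<bar>x $ i\<bar> \<le> r * norm x"
      using r component_le_norm_cart[of x i] by (intro mult_left_mono) auto
    also have "\<dots> \<le> t" using r(2) by (simp add: t_def)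
    finally show ?thesis using r(1) by (simp add: pos_le_divide_eq mult.commute)
  qed
  then have "\<bar>\<Prod>i\<in>UNIV. (x $ i) ^ \<alpha> i\<bar> \<le> (\<Prod>i\<in>UNIV. (t / r) ^ \<alpha> i)"
    unfolding abs_prod power_abs by (intro prod_mono conjI power_mono) auto
  also have "\<dots> = (t / r) ^ sum \<alpha> UNIV" by (simp add: power_sum)
  finally have "\<bar>frac_monom l \<alpha> j x\<bar> \<le> (t / r) ^ sum \<alpha> UNIV / t ^ (sum \<alpha> UNIV + j)"
    using t by (simp add: frac_monom_def t_def[symmetric] divide_right_mono)
  also have "\<dots> = (1 / r) ^ sum \<alpha> UNIV / t ^ j"
    using t by (simp add: power_divide power_add)
  finally show ?thesis by (simp add: t_def)
qed

lemma borel_measurable_frac_monom: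
  fixes l :: "real ^ 'd::finite"
  shows "frac_monom l \<alpha> j \<in> borel_measurable borel"
proof -
  have [measurable]: "(\<lambda>x :: real ^ 'd. x $ i) \<in> borel_measurable borel" for i
    by (intro borel_measurable_continuous_onI continuous_intros)
  show ?thesis unfolding frac_monom_def by measurable
qed

lemma finite_frac_monoms:
  "finite {frac_monom l \<alpha> j |(\<alpha> :: 'd::finite \<Rightarrow> nat) j. sum \<alpha> UNIV + j \<le> n}" (is "finite ?S")
proof -
  have "\<alpha> i \<le> sum \<alpha> UNIV" for \<alpha> :: "'d \<Rightarrow> nat" and i by (rule member_le_sum) auto
  \<comment> \<open>Each exponent is at most the total degree, hence at most \<open>n\<close>, which
    leaves finitely many index pairs.\<close>
  then have "?S \<subseteq> (\<lambda>(\<alpha>, j). frac_monom l \<alpha> j) ` ((\<Pi>\<^sub>E i\<in>UNIV. {..n}) \<times> {..n})"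
    by (fastforce simp: PiE_UNIV_domain intro: le_trans)
  then show ?thesis by (rule finite_subset) (intro finite_imageI finite_cartesian_product finite_PiE, auto)
qed

locale truncated_multiplication =
  fixes \<Gamma> :: "(real ^ 'd::finite) set" and \<mu> :: "(real ^ 'd) measure" and l :: "real ^ 'd"
    and n :: nat
  assumes finite_mu: "finite_measure \<mu>"
    and sets_mu: "sets \<mu> = sets (restrict_space borel (dual_cone \<Gamma>))"
    and l_interior: "l \<in> interior \<Gamma>"
begin

lemma space_mu: "space \<mu> = dual_cone \<Gamma>"
  using sets_eq_imp_space_eq[OF sets_mu] by (simp add: space_restrict_space)

lemma measurable_mu: "f \<in> borel_measurable borel \<Longrightarrow> f \<in> borel_measurable \<mu>"
  unfolding measurable_cong_sets[OF sets_mu refl] by (rule measurable_restrict_space1)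

lemma frac_monom_bounded: "frac_monom l \<alpha> j \<in> bounded_measurable \<mu>"
proof -
  obtain r where r: "0 < r" "\<And>x. x \<in> dual_cone \<Gamma> \<Longrightarrow> r * norm x \<le> l \<bullet> x"
    using dual_cone_norm_bound[OF l_interior] by blast
  have "\<bar>frac_monom l \<alpha> j x\<bar> \<le> (1 / r) ^ sum \<alpha> UNIV" if x: "x \<in> dual_cone \<Gamma>" for x
  proof -
    have "0 \<le> r * norm x" using r by simp
    then have "0 \<le> l \<bullet> x" using r(2)[OF x] by linarith
    then have "1 \<le> (1 + l \<bullet> x) ^ j" by (intro one_le_power) simp
    then have "(1 / r) ^ sum \<alpha> UNIV / (1 + l \<bullet> x) ^ j \<le> (1 / r) ^ sum \<alpha> UNIV / 1"
      using r by (intro divide_left_mono) auto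
    then show ?thesis using frac_monom_bound[OF r(1) r(2)[OF x], of \<alpha> j] by simp
  qed
  then show ?thesis
    using measurable_mu[OF borel_measurable_frac_monom]
    by (auto simp: bounded_measurable_def space_mu)
qed

text \<open>The spare denominator factor granted by \<open>1 \<le> j\<close> compensates the growth
  of the extra coordinate. This is why multiplication is applied only after projecting to
  \<open>L_space\<close>.\<close>

lemma mult_op_frac_monom_bounded:
  assumes "1 \<le> j"
  shows "mult_op i (frac_monom l \<alpha> j) \<in> bounded_measurable \<mu>"
proof -
  obtain r where r: "0 < r" "\<And>x. x \<in> dual_cone \<Gamma> \<Longrightarrow> r * norm x \<le> l \<bullet> x"
    using dual_cone_norm_bound[OF l_interior] by blast
  have "\<bar>x $ i * frac_monom l \<alpha> j x\<bar> \<le> 1 / r * (1 / r) ^ sum \<alpha> UNIV" if x: "x \<in> dual_cone \<Gamma>" for x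
  proof -
    define t where "t = 1 + l \<bullet> x"
    have "0 \<le> r * norm x" using r by simp
    then have t: "1 \<le> t" using r(2)[OF x] unfolding t_def by linarith
    have "r * \<bar>x $ i\<bar> \<le> r * norm x"
      using r component_le_norm_cart[of x i] by (intro mult_left_mono) auto
    also have "\<dots> \<le> t" using r(2)[OF x] by (simp add: t_def)
    finally have xi: "\<bar>x $ i\<bar> \<le> t / r" using r(1) by (simp add: pos_le_divide_eq mult.commute)
    have "t \<le> t ^ j" using t assms by (intro self_le_power) auto
    then have "(1 / r) ^ sum \<alpha> UNIV / t ^ j \<le> (1 / r) ^ sum \<alpha> UNIV / t"
      using r t by (intro divide_left_mono) auto
    then have "\<bar>frac_monom l \<alpha> j x\<bar> \<le> (1 / r) ^ sum \<alpha> UNIV / t"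
      using frac_monom_bound[OF r(1) r(2)[OF x], of \<alpha> j] by (simp add: t_def)
    then have "\<bar>x $ i\<bar> * \<bar>frac_monom l \<alpha> j x\<bar> \<le> t / r * ((1 / r) ^ sum \<alpha> UNIV / t)"
      using xi r t by (intro mult_mono) auto
    also have "\<dots> = 1 / r * (1 / r) ^ sum \<alpha> UNIV" using t by simp
    finally show ?thesis by (simp add: abs_mult)
  qed
  moreover have "(\<lambda>x. x $ i * frac_monom l \<alpha> j x) \<in> borel_measurable \<mu>"
  proof (intro measurable_mu borel_measurable_times borel_measurable_frac_monom)
    show "(\<lambda>x :: real ^ 'd. x $ i) \<in> borel_measurable borel"
      by (intro borel_measurable_continuous_onI continuous_intros)
  qed
  ultimately show ?thesis
    unfolding bounded_measurable_def mult_op_def space_mu by blast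
qed

sublocale finite_measure \<mu> by (rule finite_mu)

sublocale H: finite_L2 \<mu> "H_space l n" "{frac_monom l \<alpha> j |\<alpha> j. sum \<alpha> UNIV + j \<le> n}"
  by unfold_locales (auto simp: H_space_def finite_frac_monoms frac_monom_bounded)

sublocale L: finite_L2 \<mu> "L_space l n" "{frac_monom l \<alpha> j |\<alpha> j. sum \<alpha> UNIV + j \<le> n \<and> 1 \<le> j}"
  by unfold_locales
    (auto simp: L_space_def frac_monom_bounded intro: finite_subset[OF _ finite_frac_monoms])

lemma L_subset_H: "L_space l n \<subseteq> H_space l n"
  unfolding L_space_def H_space_def by (rule span_mono) blast

lemma mult_op_bounded:
  assumes "f \<in> L_space l n"
  shows "mult_op i f \<in> bounded_measurable \<mu>"
proof -
  have zero: "mult_op i 0 = 0" by (simp add: mult_op_def fun_eq_iff)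
  have add: "mult_op i (f + g) = mult_op i f + mult_op i g" for f g
    by (simp add: mult_op_def fun_eq_iff algebra_simps)
  have scale: "mult_op i (c *\<^sub>R f) = c *\<^sub>R mult_op i f" for c f
    by (simp add: mult_op_def fun_eq_iff scaleR_fun_def)
  have "subspace {f. mult_op i f \<in> bounded_measurable \<mu>}"
    by (simp add: subspace_def zero add scale)
  moreover have "{frac_monom l \<alpha> j |\<alpha> j. sum \<alpha> UNIV + j \<le> n \<and> 1 \<le> j}
      \<subseteq> {f. mult_op i f \<in> bounded_measurable \<mu>}"
    using mult_op_frac_monom_bounded by blast
  ultimately show ?thesis
    using assms span_minimal unfolding L_space_def by blast
qed

section \<open>Compressed multiplication operators\<close>

lemma pi_n_in_L: "f \<in> H_space l n \<Longrightarrow> pi_n \<mu> l n f \<in> L_space l n"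
  unfolding pi_n_def using H.V_bounded by (intro L.L2_proj) auto

lemma A_op_eq_proj:
  "A_op \<mu> l n j f = L2_proj \<mu> (L_space l n) (mult_op j (pi_n \<mu> l n f))"
  by (simp only: A_op_def pi_n_def)

lemma A_op_in_L: "f \<in> H_space l n \<Longrightarrow> A_op \<mu> l n j f \<in> L_space l n"
  unfolding A_op_eq_proj by (intro L.L2_proj mult_op_bounded pi_n_in_L)

text \<open>The outer projection is moved onto \<open>g\<close>. What remains is an integral of the
  j-th coordinate times two projected functions, visibly symmetric in \<open>f\<close> and
  \<open>g\<close>.\<close>

lemma A_op_inner:
  assumes f: "f \<in> H_space l n" and g: "g \<in> H_space l n"
  shows "L2_inner \<mu> (A_op \<mu> l n j f) g = L2_inner \<mu> (mult_op j (pi_n \<mu> l n f)) (pi_n \<mu> l n g)"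
proof -
  have A: "A_op \<mu> l n j f \<in> L_space l n" by (rule A_op_in_L[OF f])
  have "L2_inner \<mu> (A_op \<mu> l n j f) g = L2_inner \<mu> g (A_op \<mu> l n j f)"
    by (simp add: L2_inner_def mult.commute)
  also have "\<dots> = L2_inner \<mu> (pi_n \<mu> l n g) (A_op \<mu> l n j f)"
    unfolding pi_n_def using L.L2_inner_proj[OF subsetD[OF H.V_bounded g] A] by (rule HOL.sym)
  also have "\<dots> = L2_inner \<mu> (A_op \<mu> l n j f) (pi_n \<mu> l n g)"
    by (simp add: L2_inner_def mult.commute)
  also have "\<dots> = L2_inner \<mu> (mult_op j (pi_n \<mu> l n f)) (pi_n \<mu> l n g)"
    unfolding A_op_eq_proj by (intro L.L2_inner_proj mult_op_bounded pi_n_in_L f g)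
  finally show ?thesis .
qed

lemma symmetric_A_op: "H.symmetric (A_op \<mu> l n j)"
  unfolding H.symmetric_def
proof (intro conjI ballI)
  fix f g assume f: "f \<in> H_space l n" and g: "g \<in> H_space l n"
  have "L2_inner \<mu> (A_op \<mu> l n j f) g = L2_inner \<mu> (A_op \<mu> l n j g) f"
    unfolding A_op_inner[OF f g] A_op_inner[OF g f]
    by (simp add: L2_inner_def mult_op_def mult_ac)
  then show "L2_inner \<mu> (A_op \<mu> l n j f) g = L2_inner \<mu> f (A_op \<mu> l n j g)"
    by (simp add: L2_inner_def mult.commute)
qed (use A_op_in_L L_subset_H in blast)

lemma L_op_apply: "L_op \<mu> l n p f = (\<Sum>j\<in>UNIV. p $ j *\<^sub>R A_op \<mu> l n j f)"
  unfolding L_op_def by (simp only: sum_fun_apply scaleR_fun_apply)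

lemma A_op_in_H: "f \<in> H_space l n \<Longrightarrow> A_op \<mu> l n j f \<in> H_space l n"
  using A_op_in_L L_subset_H by blast

lemma L_op_inner:
  assumes "f \<in> H_space l n" "g \<in> H_space l n"
  shows "L2_inner \<mu> (L_op \<mu> l n p f) g = (\<Sum>j\<in>UNIV. p $ j * L2_inner \<mu> (A_op \<mu> l n j f) g)"
  unfolding L_op_apply using assms A_op_in_H by (intro H.lincomb_left)

lemma symmetric_L_op: "H.symmetric (L_op \<mu> l n p)"
  unfolding H.symmetric_def
proof (intro conjI ballI)
  fix f g assume f: "f \<in> H_space l n" and g: "g \<in> H_space l n"
  show "L_op \<mu> l n p f \<in> H_space l n" using f A_op_in_H by (auto simp: L_op_apply)
  have "L2_inner \<mu> f (L_op \<mu> l n p g) = L2_inner \<mu> (L_op \<mu> l n p g) f"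
    by (simp add: L2_inner_def mult.commute)
  moreover have "L2_inner \<mu> (A_op \<mu> l n j f) g = L2_inner \<mu> (A_op \<mu> l n j g) f" for j
    using H.symmetric_swap[OF symmetric_A_op f g] by (simp add: L2_inner_def mult.commute)
  ultimately show "L2_inner \<mu> (L_op \<mu> l n p f) g = L2_inner \<mu> f (L_op \<mu> l n p g)"
    by (simp add: L_op_inner f g)
qed

text \<open>\<open>L(p)\<close> is the compression of multiplication by \<open>p \<cdot> x\<close>, which is nonnegative on \<open>\<Gamma>\<^sup>*\<close>.\<close>

lemma L_op_nonneg:
  assumes p: "p \<in> \<Gamma>" and f: "f \<in> H_space l n"
  shows "0 \<le> L2_inner \<mu> (L_op \<mu> l n p f) f"
proof -
  define q where "q = pi_n \<mu> l n f"
  have q: "q \<in> L_space l n" unfolding q_def by (rule pi_n_in_L[OF f])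
  have int: "integrable \<mu> (\<lambda>x. mult_op j q x * q x)" for j
    using q L.V_bounded by (intro integrable_mult_bounded_measurable mult_op_bounded) auto
  have "L2_inner \<mu> (L_op \<mu> l n p f) f = (\<Sum>j\<in>UNIV. p $ j * (\<integral>x. mult_op j q x * q x \<partial>\<mu>))"
    unfolding L_op_inner[OF f f] A_op_inner[OF f f] by (simp add: q_def L2_inner_def)
  also have "\<dots> = (\<integral>x. (\<Sum>j\<in>UNIV. p $ j * (mult_op j q x * q x)) \<partial>\<mu>)"
    using int by (subst Bochner_Integration.integral_sum) auto
  also have "\<dots> = (\<integral>x. (p \<bullet> x) * (q x)\<^sup>2 \<partial>\<mu>)"
    by (simp add: mult_op_def inner_vec_def sum_distrib_left power2_eq_square mult_ac)
  also have "0 \<le> \<dots>"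
  proof (rule integral_nonneg_AE, rule AE_I2)
    fix x assume "x \<in> space \<mu>"
    then have "0 \<le> x \<bullet> p" using p by (auto simp: space_mu dual_cone_def)
    then show "0 \<le> (p \<bullet> x) * (q x)\<^sup>2" by (simp add: inner_commute)
  qed
  finally show ?thesis .
qed

lemma one_bounded: "(\<lambda>_. 1) \<in> bounded_measurable \<mu>"
  by (auto simp: bounded_measurable_def)

text \<open>The Weyl words force the \<open>L(v i)\<close> to commute, which yields a common
  eigenbasis. As the \<open>v i\<close> span the whole space and \<open>L(p)\<close> is linear in
  \<open>p\<close>, it diagonalizes every \<open>L(p)\<close>, in particular each
  \<open>A_op\<close>.\<close>

lemma common_eigenbasis:
  fixes v :: "'d \<Rightarrow> real ^ 'd"
  assumes v: "inj v" "independent (range v)" "range v \<subseteq> \<Gamma>"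
    and weyl: "\<And>i j k. 1 \<le> k \<Longrightarrow>
      L2_psd_on \<mu> (H_space l n) (weyl_word k (L_op \<mu> l n (v i)) (L_op \<mu> l n (v j)))"
  obtains E \<Lambda> where "H.orthonormal_basis E"
    "\<And>e j g. e \<in> E \<Longrightarrow> g \<in> H_space l n \<Longrightarrow>
      L2_inner \<mu> (A_op \<mu> l n j e) g = \<Lambda> e $ j * L2_inner \<mu> e g"
    "\<And>e. e \<in> E \<Longrightarrow> \<Lambda> e \<in> dual_cone \<Gamma>"
proof -
  let ?T = "\<lambda>i. L_op \<mu> l n (v i)"
  have comm: "L2_inner \<mu> (?T i (?T j f)) g = L2_inner \<mu> (?T j (?T i f)) g"
    if "f \<in> H_space l n" "g \<in> H_space l n" for i j f g
  proof (rule H.weyl_psd_commute[OF symmetric_L_op symmetric_L_op L_op_nonneg _ _ that])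
    show "v i \<in> \<Gamma>" using v by auto
    \<comment> \<open>\<open>L2_psd_on\<close> supplies the symmetry of the inner products; that the
      word maps \<open>H_space\<close> to itself has to be added.\<close>
    show "H.symmetric (weyl_word k (?T i) (?T j))" if "1 \<le> k" for k
      using weyl[OF that, of i j] H.weyl_word_closed[OF symmetric_L_op symmetric_L_op]
      by (auto simp: H.symmetric_def L2_psd_on_def)
    show "0 \<le> L2_inner \<mu> (weyl_word k (?T i) (?T j) f) f"
      if "1 \<le> k" "f \<in> H_space l n" for k f
      using weyl[OF that(1), of i j] that(2) by (auto simp: L2_psd_on_def)
  qed
  obtain E where E: "H.orthonormal_basis E"
    and eig: "\<And>e i. e \<in> E \<Longrightarrow> \<exists>c. \<forall>g\<in>H_space l n. L2_inner \<mu> (?T i e) g = c * L2_inner \<mu> e g"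
    using H.simultaneous_diagonalization[of UNIV ?T, OF finite symmetric_L_op comm]
    by (metis UNIV_I)
  have on: "H.orthonormal E" and EH: "E \<subseteq> H_space l n"
    using E by (auto simp: H.orthonormal_basis_def H.orthonormal_def)
  \<comment> \<open>As \<open>e\<close> will be a unit vector, an eigenvalue of \<open>A_op\<close>
    at \<open>e\<close> can only be this Rayleigh quotient.\<close>
  define \<Lambda> where "\<Lambda> e = (\<chi> j. L2_inner \<mu> (A_op \<mu> l n j e) e)" for e
  have "UNIV \<subseteq> span (range v)"
    using v(1,2) by (intro card_ge_dim_independent) (auto simp: card_image)
  then have span: "p \<in> span (range v)" for p by auto
  have all: "\<exists>c. \<forall>g\<in>H_space l n. L2_inner \<mu> (L_op \<mu> l n p e) g = c * L2_inner \<mu> e g"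
    (is "?P p") if e: "e \<in> E" for e p
    using span[of p]
  proof (induction p rule: span_induct_alt)
    case base
    show ?case using e EH by (intro exI[of _ 0]) (auto simp: L_op_inner)
  next
    case (step c x y)
    obtain i where x: "x = v i" using step by blast
    obtain a where a: "\<forall>g\<in>H_space l n. L2_inner \<mu> (L_op \<mu> l n x e) g = a * L2_inner \<mu> e g"
      using eig[OF e] x by blast
    obtain b where b: "\<forall>g\<in>H_space l n. L2_inner \<mu> (L_op \<mu> l n y e) g = b * L2_inner \<mu> e g"
      using step by blast
    have "L2_inner \<mu> (L_op \<mu> l n (c *\<^sub>R x + y) e) g = (c * a + b) * L2_inner \<mu> e g"
      if g: "g \<in> H_space l n" for g
    proof -
      have "L2_inner \<mu> (L_op \<mu> l n (c *\<^sub>R x + y) e) g =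
          c * L2_inner \<mu> (L_op \<mu> l n x e) g + L2_inner \<mu> (L_op \<mu> l n y e) g"
        using e EH g by (simp add: L_op_inner subset_iff sum.distrib distrib_right
            sum_distrib_left mult.assoc)
      then show ?thesis using a b g by (simp add: algebra_simps)
    qed
    then show ?case by blast
  qed
  have A_eig: "L2_inner \<mu> (A_op \<mu> l n j e) g = \<Lambda> e $ j * L2_inner \<mu> e g"
    if e: "e \<in> E" and g: "g \<in> H_space l n" for e j g
  proof -
    have eH: "e \<in> H_space l n" and ee: "L2_inner \<mu> e e = 1"
      using e EH on by (auto simp: H.orthonormal_def)
    obtain c where c: "\<forall>g\<in>H_space l n. L2_inner \<mu> (L_op \<mu> l n (axis j 1) e) g = c * L2_inner \<mu> e g"
      using all[OF e] by blast
    have "L_op \<mu> l n (axis j 1) e = (\<Sum>i\<in>UNIV. if i = j then A_op \<mu> l n i e else 0)"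
      unfolding L_op_apply by (intro sum.cong) (auto simp: axis_def)
    then have "L_op \<mu> l n (axis j 1) e = A_op \<mu> l n j e" by simp
    then show ?thesis using c eH ee g by (simp add: \<Lambda>_def)
  qed
  moreover have "\<Lambda> e \<in> dual_cone \<Gamma>" if e: "e \<in> E" for e
  proof -
    have eH: "e \<in> H_space l n" using e EH by blast
    \<comment> \<open>Pairing the joint eigenvalue with \<open>p\<close> gives the Rayleigh quotient
      of \<open>L(p)\<close>, nonnegative for \<open>p\<close> in \<Gamma>.\<close>
    have "\<Lambda> e \<bullet> p = L2_inner \<mu> (L_op \<mu> l n p e) e" for p
      by (simp add: L_op_inner[OF eH eH] inner_vec_def \<Lambda>_def mult.commute)
    then show ?thesis using L_op_nonneg[OF _ eH] by (simp add: dual_cone_def)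
  qed
  ultimately show ?thesis using that E by blast
qed

end

section \<open>The resolvent in the eigenbasis\<close>

lemma L2_cinner_of_real:
  assumes "finite_measure M"
    and "(\<lambda>x. Re (u x)) \<in> bounded_measurable M" "(\<lambda>x. Im (u x)) \<in> bounded_measurable M"
    and "g \<in> bounded_measurable M"
  shows "L2_cinner M u (\<lambda>x. complex_of_real (g x)) =
    Complex (L2_inner M (\<lambda>x. Re (u x)) g) (L2_inner M (\<lambda>x. Im (u x)) g)"
proof -
  interpret finite_measure M by fact
  have int: "integrable M (\<lambda>x. Re (u x) * g x)" "integrable M (\<lambda>x. Im (u x) * g x)"
    using assms by (auto intro: integrable_mult_bounded_measurable)
  have eq: "u x * cnj (complex_of_real (g x)) =
      complex_of_real (Re (u x) * g x) + \<i> * complex_of_real (Im (u x) * g x)" for x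
    by (simp add: complex_eq_iff)
  have "L2_cinner M u (\<lambda>x. complex_of_real (g x)) =
      complex_of_real (\<integral>x. Re (u x) * g x \<partial>M) + \<i> * complex_of_real (\<integral>x. Im (u x) * g x \<partial>M)"
    unfolding L2_cinner_def eq using int by (simp del: of_real_mult)
  then show ?thesis by (simp add: L2_inner_def complex_eq_iff)
qed

context truncated_multiplication
begin

text \<open>The operators act on real functions only, so the complex pencil is split into real
  combinations to which the form on \<open>H_space\<close> applies.\<close>

lemma pencil_Re:
  "(\<lambda>x. Re (pencil \<mu> l n z z0 u x)) =
    Re z0 *\<^sub>R (\<lambda>x. Re (u x)) - Im z0 *\<^sub>R (\<lambda>x. Im (u x)) +
    (\<Sum>j\<in>UNIV. Re (z $ j) *\<^sub>R A_op \<mu> l n j (\<lambda>x. Re (u x)) -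
      Im (z $ j) *\<^sub>R A_op \<mu> l n j (\<lambda>x. Im (u x)))"
  by (simp add: fun_eq_iff pencil_def complexify_op_def sum_fun_apply scaleR_fun_apply)

lemma pencil_Im:
  "(\<lambda>x. Im (pencil \<mu> l n z z0 u x)) =
    Re z0 *\<^sub>R (\<lambda>x. Im (u x)) + Im z0 *\<^sub>R (\<lambda>x. Re (u x)) +
    (\<Sum>j\<in>UNIV. Re (z $ j) *\<^sub>R A_op \<mu> l n j (\<lambda>x. Im (u x)) +
      Im (z $ j) *\<^sub>R A_op \<mu> l n j (\<lambda>x. Re (u x)))"
  by (simp add: fun_eq_iff pencil_def complexify_op_def sum_fun_apply scaleR_fun_apply add.commute)

lemma pencil_closed:
  assumes "u \<in> complexify_space (H_space l n)"
  shows "pencil \<mu> l n z z0 u \<in> complexify_space (H_space l n)"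
  using assms unfolding complexify_space_def mem_Collect_eq pencil_Re pencil_Im
  by (intro conjI H.closed_simps A_op_in_H) auto

text \<open>By symmetry each \<open>A_op\<close> is moved onto \<open>e\<close>, where it acts as a
  scalar. Along \<open>e\<close> the pencil is therefore multiplication by the denominator of one
  partial fraction.\<close>

lemma pencil_coeff:
  assumes u: "u \<in> complexify_space (H_space l n)" and e: "e \<in> H_space l n"
    and eig: "\<And>j g. g \<in> H_space l n \<Longrightarrow>
      L2_inner \<mu> (A_op \<mu> l n j e) g = \<Lambda> $ j * L2_inner \<mu> e g"
  shows "Complex (L2_inner \<mu> (\<lambda>x. Re (pencil \<mu> l n z z0 u x)) e)
      (L2_inner \<mu> (\<lambda>x. Im (pencil \<mu> l n z z0 u x)) e) =
    (z0 + (\<Sum>i\<in>UNIV. z $ i * complex_of_real (\<Lambda> $ i))) *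
      Complex (L2_inner \<mu> (\<lambda>x. Re (u x)) e) (L2_inner \<mu> (\<lambda>x. Im (u x)) e)"
proof -
  define a b where "a = (\<lambda>x. Re (u x))" and "b = (\<lambda>x. Im (u x))"
  have a: "a \<in> H_space l n" and b: "b \<in> H_space l n"
    using u by (auto simp: complexify_space_def a_def b_def)
  have A: "L2_inner \<mu> (A_op \<mu> l n j f) e = \<Lambda> $ j * L2_inner \<mu> f e"
    if f: "f \<in> H_space l n" for f j
    using eig[OF f, of j] H.symmetric_swap[OF symmetric_A_op f e, of j]
    by (simp add: L2_inner_def mult.commute)
  note [simp] = a b e A A_op_in_H H.add_left H.diff_left H.scale_left H.sum_left
  have re: "L2_inner \<mu> (\<lambda>x. Re (pencil \<mu> l n z z0 u x)) e =
      Re z0 * L2_inner \<mu> a e - Im z0 * L2_inner \<mu> b e +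
      (\<Sum>j\<in>UNIV. Re (z $ j) * (\<Lambda> $ j * L2_inner \<mu> a e) - Im (z $ j) * (\<Lambda> $ j * L2_inner \<mu> b e))"
    unfolding pencil_Re a_def[symmetric] b_def[symmetric] by simp
  have im: "L2_inner \<mu> (\<lambda>x. Im (pencil \<mu> l n z z0 u x)) e =
      Re z0 * L2_inner \<mu> b e + Im z0 * L2_inner \<mu> a e +
      (\<Sum>j\<in>UNIV. Re (z $ j) * (\<Lambda> $ j * L2_inner \<mu> b e) + Im (z $ j) * (\<Lambda> $ j * L2_inner \<mu> a e))"
    unfolding pencil_Im a_def[symmetric] b_def[symmetric] by simp
  show ?thesis
    unfolding re im a_def[symmetric] b_def[symmetric]
    by (simp add: complex_eq_iff algebra_simps sum.distrib sum_subtractf sum_distrib_left)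
qed

text \<open>Along \<open>E\<close> the resolvent equation decouples into scalar equations, solved by
  division. Pairing the solution with \<open>v\<close> by Parseval leaves the squared coefficients
  of \<open>v\<close>.\<close>

lemma Phi_eigenbasis:
  assumes E: "H.orthonormal_basis E"
    and eig: "\<And>e j g. e \<in> E \<Longrightarrow> g \<in> H_space l n \<Longrightarrow>
      L2_inner \<mu> (A_op \<mu> l n j e) g = \<Lambda> e $ j * L2_inner \<mu> e g"
    and D_nonzero: "\<And>e. e \<in> E \<Longrightarrow> z0 + (\<Sum>i\<in>UNIV. z $ i * complex_of_real (\<Lambda> e $ i)) \<noteq> 0"
  shows "Phi \<mu> l n z z0 =
    (\<Sum>e\<in>E. complex_of_real ((L2_inner \<mu> (pi_n \<mu> l n (\<lambda>_. 1)) e)\<^sup>2) /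
      (z0 + (\<Sum>i\<in>UNIV. z $ i * complex_of_real (\<Lambda> e $ i))))"
proof -
  let ?H = "H_space l n" and ?W = "complexify_space (H_space l n)"
  define D where "D e = z0 + (\<Sum>i\<in>UNIV. z $ i * complex_of_real (\<Lambda> e $ i))" for e
  define v where "v = pi_n \<mu> l n (\<lambda>_. 1)"
  define P where "P = pencil \<mu> l n z z0"
  define coeff where
    "coeff u e = Complex (L2_inner \<mu> (\<lambda>x. Re (u x)) e) (L2_inner \<mu> (\<lambda>x. Im (u x)) e)"
    for u :: "real ^ 'd \<Rightarrow> complex" and e
  have on: "H.orthonormal E" and EH: "E \<subseteq> ?H"
    using E by (auto simp: H.orthonormal_basis_def H.orthonormal_def)
  have vH: "v \<in> ?H"
    unfolding v_def pi_n_def using L.L2_proj(1)[OF one_bounded] L_subset_H by blast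
  have coeff_P: "coeff (P u) e = D e * coeff u e" if "u \<in> ?W" "e \<in> E" for u e
    unfolding coeff_def P_def D_def using that EH eig by (intro pencil_coeff) auto
  have zero_AE: "AE x in \<mu>. f x = 0" if "f \<in> ?H" "\<And>e. e \<in> E \<Longrightarrow> L2_inner \<mu> f e = 0" for f
    using that E H.V_bounded by (intro L2_null_AE) (auto simp: H.orthonormal_basis_def)
  define w where "w e = complex_of_real (L2_inner \<mu> v e) / D e" for e
  \<comment> \<open>\<open>u0\<close> is the explicit solution; completeness of \<open>E\<close>
    upgrades equality of coefficients to equality almost everywhere.\<close>
  define u0 where "u0 x = (\<Sum>e\<in>E. w e * complex_of_real (e x))" for x
  have re0: "(\<lambda>x. Re (u0 x)) = (\<Sum>e\<in>E. Re (w e) *\<^sub>R e)"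
    and im0: "(\<lambda>x. Im (u0 x)) = (\<Sum>e\<in>E. Im (w e) *\<^sub>R e)"
    by (simp_all add: u0_def fun_eq_iff sum_fun_apply scaleR_fun_apply)
  have u0W: "u0 \<in> ?W"
    unfolding complexify_space_def mem_Collect_eq re0 im0 using EH by auto
  have P0: "coeff (P u0) e = complex_of_real (L2_inner \<mu> v e)" if e: "e \<in> E" for e
  proof -
    have "coeff u0 e = w e"
      unfolding coeff_def re0 im0 by (simp add: H.orthonormal_coeff[OF on e])
    then show ?thesis
      using coeff_P[OF u0W e] D_nonzero[OF e] by (simp add: w_def D_def)
  qed
  have PH: "(\<lambda>x. Re (P u x)) \<in> ?H" "(\<lambda>x. Im (P u x)) \<in> ?H" if "u \<in> ?W" for u
    using pencil_closed[OF that] by (auto simp: P_def complexify_space_def)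
  have "AE x in \<mu>. ((\<lambda>x. Re (P u0 x)) - v) x = 0"
  proof (rule zero_AE)
    show "(\<lambda>x. Re (P u0 x)) - v \<in> ?H" using PH(1)[OF u0W] vH by blast
    show "L2_inner \<mu> ((\<lambda>x. Re (P u0 x)) - v) e = 0" if "e \<in> E" for e
      using P0[OF that] H.diff_left[OF PH(1)[OF u0W] vH] that EH
      by (auto simp: coeff_def complex_eq_iff)
  qed
  moreover have "AE x in \<mu>. Im (P u0 x) = 0"
  proof (rule zero_AE[OF PH(2)[OF u0W]])
    show "L2_inner \<mu> (\<lambda>x. Im (P u0 x)) e = 0" if "e \<in> E" for e
      using P0[OF that] by (auto simp: coeff_def complex_eq_iff)
  qed
  ultimately have "AE x in \<mu>. P u0 x = complex_of_real (v x)"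
    by eventually_elim (simp add: complex_eq_iff)
  then have ex: "\<exists>u. u \<in> ?W \<and> (AE x in \<mu>. P u x = complex_of_real (v x))" using u0W by blast
  define u where "u = L2_inv_on \<mu> ?W P (\<lambda>x. complex_of_real (v x))"
  have uW: "u \<in> ?W" and Pu: "AE x in \<mu>. P u x = complex_of_real (v x)"
    using someI_ex[OF ex] by (auto simp: u_def L2_inv_on_def)
  \<comment> \<open>Whatever solution the choice in \<open>L2_inv_on\<close> picks, its coefficients
    are determined, as the denominators are nonzero.\<close>
  have coeff_u: "coeff u e = w e" if e: "e \<in> E" for e
  proof -
    have eH: "e \<in> ?H" using e EH by blast
    have "AE x in \<mu>. ((\<lambda>x. Re (P u x)) - v) x = 0" "AE x in \<mu>. Im (P u x) = 0"
      using Pu by (eventually_elim, simp)+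
    then have "L2_inner \<mu> ((\<lambda>x. Re (P u x)) - v) e = 0" "L2_inner \<mu> (\<lambda>x. Im (P u x)) e = 0"
      by (auto intro: L2_inner_AE_zero)
    then have "coeff (P u) e = complex_of_real (L2_inner \<mu> v e)"
      using H.diff_left[OF PH(1)[OF uW] vH eH] by (simp add: coeff_def complex_eq_iff)
    then show ?thesis
      using coeff_P[OF uW e] D_nonzero[OF e] by (simp add: w_def D_def field_simps)
  qed
  have uH: "(\<lambda>x. Re (u x)) \<in> ?H" "(\<lambda>x. Im (u x)) \<in> ?H"
    using uW by (auto simp: complexify_space_def)
  have "Phi \<mu> l n z z0 = L2_cinner \<mu> u (\<lambda>x. complex_of_real (v x))"
    by (simp add: Phi_def Let_def u_def P_def v_def)
  also have "\<dots> = Complex (L2_inner \<mu> (\<lambda>x. Re (u x)) v) (L2_inner \<mu> (\<lambda>x. Im (u x)) v)"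
    using uH vH H.V_bounded finite_mu by (intro L2_cinner_of_real) auto
  also have "\<dots> = (\<Sum>e\<in>E. coeff u e * complex_of_real (L2_inner \<mu> e v))"
    unfolding H.Parseval[OF E uH(1) vH] H.Parseval[OF E uH(2) vH]
    by (simp add: complex_eq_iff coeff_def)
  also have "\<dots> = (\<Sum>e\<in>E. complex_of_real ((L2_inner \<mu> v e)\<^sup>2) / D e)"
  proof (intro sum.cong refl)
    fix e assume e: "e \<in> E"
    have "L2_inner \<mu> e v = L2_inner \<mu> v e" by (simp add: L2_inner_def mult.commute)
    then show "coeff u e * complex_of_real (L2_inner \<mu> e v) =
        complex_of_real ((L2_inner \<mu> v e)\<^sup>2) / D e"
      by (simp add: coeff_u[OF e] w_def power2_eq_square)
  qed
  finally show ?thesis by (simp add: v_def D_def)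
qed

end

section \<open>Partial fractions with nonnegative weights and poles governed by the dual
  cone\<close>

theorem corollary7p4:
  fixes \<Gamma> :: "(real ^ 'd::finite) set"
    and \<mu> :: "(real ^ 'd) measure"
    and l :: "real ^ 'd"
    and n :: nat
  assumes "closed \<Gamma>" and "convex_cone \<Gamma>" and "acute \<Gamma>" and "solid \<Gamma>"
    and "finite_measure \<mu>" and "sets \<mu> = sets (restrict_space borel (dual_cone \<Gamma>))"
    and "l \<in> interior \<Gamma>"
    and "\<And>R p. extreme_ray R \<Gamma> \<Longrightarrow> p \<in> R \<Longrightarrow> L2_psd_on \<mu> (H_space l n) (L_op \<mu> l n p)"
    and "\<exists>v :: 'd \<Rightarrow> real ^ 'd.
           inj v \<and> independent (range v) \<and> (\<forall>i. \<exists>R. extreme_ray R \<Gamma> \<and> v i \<in> R) \<and>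
           (\<forall>i j. \<forall>k\<ge>1. L2_psd_on \<mu> (H_space l n)
              (weyl_word k (L_op \<mu> l n (v i)) (L_op \<mu> l n (v j))))"
  shows "\<exists>(\<gamma> :: nat \<Rightarrow> real) (\<Lambda> :: nat \<Rightarrow> real ^ 'd).
           (\<forall>m\<in>{1..L2_dim \<mu> (H_space l n)}. 0 \<le> \<gamma> m \<and> \<Lambda> m \<in> dual_cone \<Gamma>) \<and>
           (\<forall>(z, z0)\<in>tube \<Gamma>. Phi \<mu> l n z z0 =
              (\<Sum>m=1..L2_dim \<mu> (H_space l n).
                 complex_of_real (\<gamma> m) / (z0 + (\<Sum>i\<in>UNIV. z $ i * complex_of_real (\<Lambda> m $ i)))))"
proof -
  interpret truncated_multiplication \<Gamma> \<mu> l n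
    by (rule truncated_multiplication.intro[OF assms(5-7)])
  obtain v :: "'d \<Rightarrow> real ^ 'd" where v: "inj v" "independent (range v)"
    and ray: "\<And>i. \<exists>R. extreme_ray R \<Gamma> \<and> v i \<in> R"
    and weyl: "\<And>i j k. 1 \<le> k \<Longrightarrow>
      L2_psd_on \<mu> (H_space l n) (weyl_word k (L_op \<mu> l n (v i)) (L_op \<mu> l n (v j)))"
    using assms(9) by blast
  have "range v \<subseteq> \<Gamma>"
    using ray by (auto simp: extreme_ray_def dest: face_of_imp_subset)
  then obtain E \<Lambda> where E: "H.orthonormal_basis E"
    and eig: "\<And>e j g. e \<in> E \<Longrightarrow> g \<in> H_space l n \<Longrightarrow>
      L2_inner \<mu> (A_op \<mu> l n j e) g = \<Lambda> e $ j * L2_inner \<mu> e g"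
    and \<Lambda>: "\<And>e. e \<in> E \<Longrightarrow> \<Lambda> e \<in> dual_cone \<Gamma>"
    using common_eigenbasis[OF v _ weyl] by metis
  have "finite E" using E by (auto simp: H.orthonormal_basis_def H.orthonormal_def)
  then obtain idx where "bij_betw idx {1..card E} E" using ex_bij_betw_nat_finite_1 by blast
  then have idx: "bij_betw idx {1..L2_dim \<mu> (H_space l n)} E"
    by (simp add: H.L2_dim_orthonormal_basis[OF E])
  \<comment> \<open>The weights are nonnegative as squares of the coefficients of the projected
    constant function.\<close>
  define \<gamma> where "\<gamma> e = (L2_inner \<mu> (pi_n \<mu> l n (\<lambda>_. 1)) e)\<^sup>2" for e
  have "Phi \<mu> l n z z0 =
      (\<Sum>m=1..L2_dim \<mu> (H_space l n). complex_of_real (\<gamma> (idx m)) /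
        (z0 + (\<Sum>i\<in>UNIV. z $ i * complex_of_real (\<Lambda> (idx m) $ i))))"
    if tube: "(z, z0) \<in> tube \<Gamma>" for z z0
  proof -
    \<comment> \<open>On the tube the denominator has positive real part: \<open>Re_vec z\<close>
      lies in \<Gamma> and pairs nonnegatively with the joint eigenvalue, and \<open>Re z0\<close>
      is positive.\<close>
    have "z0 + (\<Sum>i\<in>UNIV. z $ i * complex_of_real (\<Lambda> e $ i)) \<noteq> 0" if e: "e \<in> E" for e
    proof -
      have "Re_vec z \<in> \<Gamma>" "0 < Re z0" using tube interior_subset by (auto simp: tube_def)
      then have "0 < Re z0 + \<Lambda> e \<bullet> Re_vec z" using \<Lambda>[OF e] by (auto simp: dual_cone_def add_pos_nonneg)
      also have "\<dots> = Re (z0 + (\<Sum>i\<in>UNIV. z $ i * complex_of_real (\<Lambda> e $ i)))"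
        by (simp add: inner_vec_def Re_vec_def mult.commute)
      finally show ?thesis by (metis less_irrefl zero_complex.sel(1))
    qed
    from Phi_eigenbasis[OF E eig this] show ?thesis
      by (simp add: sum.reindex_bij_betw[OF idx, symmetric] \<gamma>_def)
  qed
  moreover have "\<forall>m\<in>{1..L2_dim \<mu> (H_space l n)}. 0 \<le> \<gamma> (idx m) \<and> \<Lambda> (idx m) \<in> dual_cone \<Gamma>"
    using \<Lambda> bij_betwE[OF idx] by (simp add: \<gamma>_def)
  ultimately show ?thesis
    by (intro exI[of _ "\<lambda>m. \<gamma> (idx m)"] exI[of _ "\<lambda>m. \<Lambda> (idx m)"]) auto
qed

end
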